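(* Let $\alpha:[0,\infty)\to(0,\infty)$ be continuously differentiable, write $\alpha^*(t):=\sup_{0\le r\le t}\alpha(r)$, and assume: (i) there are $\gamma\in[0,1/2]$, $\beta>0$ and $C>0$ such that $(\alpha^*(t+1))^{2\gamma}/\alpha(t)\le C\,t^{-\beta}$ for all $0\le t<\infty$ (with $0^{-\beta}:=+\infty$); (ii) $\sup_{t\ge0}|\alpha'(t)/\alpha(t)|<\infty$; (iii) there are $\rho>1$, $t_0>0$ and a constant $C>0$ such that $\alpha(t)\ge C\,t^{\rho}$ for all $t\ge t_0$. Let $X$ be the solution of $dX_t=-\alpha(t)X_t\,dt+dW_t$, $X_0=0$, and let $\mathcal L_t=\mathcal L_t^0$ be its local time at level $0$. Then $$\lim_{t\to\infty}\mathcal L_t=\infty\quad\text{almost surely.}$$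
   Context: $W=(W_t)_{t\ge0}$ is a standard one-dimensional Brownian motion on a complete filtered probability space, and $X_t=\int_0^t\exp(-\int_s^t\alpha(u)\,du)\,dW_s$ (continuous version). The local time at level $x$, formally $\mathcal L_t^x=\int_0^t\delta(X_r-x)\,dr$ with $\delta$ the Dirac delta at $0$, is the limit in $L^2$ as $\varepsilon\to0+$ of $\mathcal L_{t,\varepsilon}^x:=\int_0^t p_\varepsilon(X_r-x)\,dr$, where $p_\varepsilon(y)=\frac1{\sqrt{2\pi\varepsilon}}e^{-y^2/(2\varepsilon)}$ (this limit exists for all $0<t<\infty$, $x\in\mathbb R$). The process $(\mathcal L_t)_{t\ge0}$ is taken in a version that is almost surely nondecreasing in $t$. *)

theory Defs
  imports "HOL-Probability.Probability"
begin

text \<open>Time is the type \<^typ>\<open>real\<close>, and every condition is imposed for nonnegative times only.\<close>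

locale complete_filtered_prob_space = prob_space M + complete_measure M
  for M :: "'a measure" +
  fixes F :: "real \<Rightarrow> 'a measure"
  assumes subalgebra_F: "\<And>t. 0 \<le> t \<Longrightarrow> subalgebra M (F t)"
    and F_mono: "\<And>s t. 0 \<le> s \<Longrightarrow> s \<le> t \<Longrightarrow> sets (F s) \<subseteq> sets (F t)"
    and null_sets_F: "null_sets M \<subseteq> sets (F 0)"

definition adapted :: "(real \<Rightarrow> 'a measure) \<Rightarrow> (real \<Rightarrow> 'a \<Rightarrow> real) \<Rightarrow> bool" where
  "adapted F X \<longleftrightarrow> (\<forall>t\<ge>0. X t \<in> borel_measurable (F t))"

definition continuous_paths :: "'a measure \<Rightarrow> (real \<Rightarrow> 'a \<Rightarrow> real) \<Rightarrow> bool" where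
  "continuous_paths M X \<longleftrightarrow> (AE \<omega> in M. continuous_on {0..} (\<lambda>t. X t \<omega>))"

definition brownian_motion ::
    "'a measure \<Rightarrow> (real \<Rightarrow> 'a measure) \<Rightarrow> (real \<Rightarrow> 'a \<Rightarrow> real) \<Rightarrow> bool" where
  "brownian_motion M F W \<longleftrightarrow>
     adapted F W \<and> continuous_paths M W \<and> (AE \<omega> in M. W 0 \<omega> = 0) \<and>
     (\<forall>s t. 0 \<le> s \<and> s < t \<longrightarrow>
        distributed M lborel (\<lambda>\<omega>. W t \<omega> - W s \<omega>) (normal_density 0 (sqrt (t - s))) \<and>
        prob_space.indep_set M (sets (F s))
          (sets (vimage_algebra (space M) (\<lambda>\<omega>. W t \<omega> - W s \<omega>) borel)))"

text \<open>
  The equation \<open>dX\<^sub>t = - \<alpha>(t) X\<^sub>t dt + dW\<^sub>t\<close>, \<open>X\<^sub>0 = 0\<close>, in integral form. The noise is additive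
  and \<open>W\<^sub>0 = 0\<close>, so the stochastic integral of the constant 1 over \<open>[0,t]\<close> is \<open>W\<^sub>t\<close>.
\<close>

definition sde_solution ::
    "'a measure \<Rightarrow> (real \<Rightarrow> 'a measure) \<Rightarrow> (real \<Rightarrow> 'a \<Rightarrow> real) \<Rightarrow> (real \<Rightarrow> real)
      \<Rightarrow> (real \<Rightarrow> 'a \<Rightarrow> real) \<Rightarrow> bool" where
  "sde_solution M F W \<alpha> X \<longleftrightarrow>
     adapted F X \<and> continuous_paths M X \<and> (AE \<omega> in M. X 0 \<omega> = 0) \<and>
     (AE \<omega> in M. \<forall>t\<ge>0. X t \<omega> = (LINT s:{0..t}|lborel. - \<alpha> s * X s \<omega>) + W t \<omega>)"

definition heat_kernel :: "real \<Rightarrow> real \<Rightarrow> real" where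
  "heat_kernel \<epsilon> y = 1 / sqrt (2 * pi * \<epsilon>) * exp (- y\<^sup>2 / (2 * \<epsilon>))"

definition approx_local_time ::
    "(real \<Rightarrow> 'a \<Rightarrow> real) \<Rightarrow> real \<Rightarrow> real \<Rightarrow> real \<Rightarrow> 'a \<Rightarrow> real" where
  "approx_local_time X x \<epsilon> t \<omega> = (LINT r:{0..t}|lborel. heat_kernel \<epsilon> (X r \<omega> - x))"

text \<open>
  \<open>L\<close> is a version of the local time of \<open>X\<close> at level \<open>x\<close>: each \<open>L t\<close> is the limit in \<open>L\<^sup>2(M)\<close> of
  the approximations (the squared distance is a nonnegative integral, so it cannot vanish for lack
  of integrability), and almost every path is nondecreasing.
\<close>

definition local_time ::
    "'a measure \<Rightarrow> (real \<Rightarrow> 'a \<Rightarrow> real) \<Rightarrow> real \<Rightarrow> (real \<Rightarrow> 'a \<Rightarrow> real) \<Rightarrow> bool" where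
  "local_time M X x L \<longleftrightarrow>
     (\<forall>t\<ge>0. L t \<in> borel_measurable M \<and> integrable M (\<lambda>\<omega>. (L t \<omega>)\<^sup>2) \<and>
        ((\<lambda>\<epsilon>. \<integral>\<^sup>+ \<omega>. ennreal ((approx_local_time X x \<epsilon> t \<omega> - L t \<omega>)\<^sup>2) \<partial>M) \<longlongrightarrow> 0)
          (at_right 0)) \<and>
     (AE \<omega> in M. mono_on {0..} (\<lambda>t. L t \<omega>))"

definition running_sup :: "(real \<Rightarrow> real) \<Rightarrow> real \<Rightarrow> real" where
  "running_sup \<alpha> t = (SUP r\<in>{0..t}. \<alpha> r)"

end

theory Submission imports Defs begin

text \<open>
  Let \<open>\<mu>\<close> be the integrating factor of the equation and \<open>clock\<close> the primitive of \<open>\<mu>\<^sup>2\<close>. Then \<open>X\<^sub>t\<close> is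
  centred Gaussian with variance \<open>var t = clock t / (\<mu> t)\<^sup>2\<close>, and the squared correlation of \<open>X\<^sub>s\<close> and
  \<open>X\<^sub>r\<close> for \<open>s < r\<close> is \<open>clock s / clock r\<close>. Since \<open>1 / var\<close> is the logarithmic derivative of \<open>clock\<close>,
  the double integral for the variance of the approximate local time is, after the AM-GM bound for
  \<open>1 / sqrt (var s * var r)\<close>, explicitly integrable and at most \<open>2 * t / pi\<close>, uniformly in \<open>\<epsilon>\<close>. As
  \<open>\<alpha>\<close> is bounded away from \<open>0\<close>, \<open>var\<close> is bounded and the mean grows at least linearly in \<open>t\<close>. By
  Chebyshev, \<open>L t\<close> exceeds a linear function of \<open>t\<close> with probability tending to \<open>1\<close>, and monotonicity
  of \<open>L\<close> turns this into almost sure divergence.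

  The Gaussian moments are obtained without stochastic integrals or characteristic functions:
  adding an independent centred Gaussian variable inside a heat kernel amounts, in expectation, to
  adding its variance to the parameter of the kernel.
\<close>

section \<open>Real analysis\<close>

lemma at_within_interior_atLeast: "a < t \<Longrightarrow> at t within {a..} = at (t::real)"
  by (rule at_within_interior) simp

lemma integral_has_real_derivative_atLeast:
  fixes f :: "real \<Rightarrow> real"
  assumes f: "continuous_on {a..} f" and t: "a \<le> t"
  shows "((\<lambda>t. integral {a..t} f) has_real_derivative f t) (at t within {a..})"
proof -
  have "((\<lambda>t. integral {a..t} f) has_real_derivative f t) (at t within {a..t + 1})"
    using t by (intro integral_has_real_derivative continuous_on_subset[OF f]) auto
  moreover have "at t within {a..t + 1} = at t within {a..}"
    by (rule at_within_nhd[where S = "{..<t + 1}"]) auto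
  ultimately show ?thesis by simp
qed

lemma continuous_on_UNIV_integral_atLeast:
  fixes f :: "real \<Rightarrow> real"
  assumes f: "continuous_on {a..} f"
  shows "continuous_on UNIV (\<lambda>t. integral {a..t} f)"
proof -
  have "continuous_on {a..} (\<lambda>t. integral {a..t} f)"
    using integral_has_real_derivative_atLeast[OF f]
    by (auto simp: continuous_on_eq_continuous_within intro!: DERIV_continuous)
  then have "continuous_on UNIV (\<lambda>t. integral {a..max a t} f)"
    by (rule continuous_on_compose2) (auto intro: continuous_intros)
  moreover have "integral {a..max a t} f = integral {a..t} f" for t
    by (auto simp: max_def)
  ultimately show ?thesis by simp
qed

lemma nn_integral_FTC_Ioo:
  fixes f F :: "real \<Rightarrow> real"
  assumes "a < b" and F: "continuous_on {a..b} F"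
    and "\<And>x. a < x \<Longrightarrow> x < b \<Longrightarrow> (F has_real_derivative f x) (at x)"
    and "\<And>x. a < x \<Longrightarrow> x < b \<Longrightarrow> isCont f x"
    and nonneg: "\<And>x. a < x \<Longrightarrow> x < b \<Longrightarrow> 0 \<le> f x"
  shows "(\<integral>\<^sup>+x\<in>{a<..<b}. ennreal (f x) \<partial>lborel) = ennreal (F b - F a)"
proof -
  have "((F \<circ> real_of_ereal) \<longlongrightarrow> F a) (at_right (ereal a))"
    using F \<open>a < b\<close> unfolding ereal_tendsto_simps
    by (metis continuous_on_Icc_at_rightD)
  moreover have "((F \<circ> real_of_ereal) \<longlongrightarrow> F b) (at_left (ereal b))"
    using F \<open>a < b\<close> unfolding ereal_tendsto_simps
    by (metis continuous_on_Icc_at_leftD)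
  ultimately have FTC: "set_integrable lborel (einterval a b) f" "(LBINT x=a..b. f x) = F b - F a"
    using interval_integral_FTC_nonneg[of a b F f "F a" "F b"] assms by auto
  have "(\<integral>\<^sup>+x\<in>{a<..<b}. ennreal (f x) \<partial>lborel) = (\<integral>\<^sup>+x. ennreal (indicator {a<..<b} x * f x) \<partial>lborel)"
    by (intro nn_integral_cong) (auto split: split_indicator)
  also have "\<dots> = ennreal (\<integral>x. indicator {a<..<b} x * f x \<partial>lborel)"
    using FTC(1) nonneg
    by (intro nn_integral_eq_integral) (auto simp: set_integrable_def split: split_indicator)
  also have "(\<integral>x. indicator {a<..<b} x * f x \<partial>lborel) = F b - F a"
    using FTC(2) \<open>a < b\<close> by (simp add: interval_lebesgue_integral_def set_lebesgue_integral_def)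
  finally show ?thesis .
qed

lemma nn_integral_deriv_div_sqrt_one_minus:
  fixes q q' :: "real \<Rightarrow> real"
  assumes "a < b" and q: "continuous_on {a..b} q"
    and deriv: "\<And>x. a < x \<Longrightarrow> x < b \<Longrightarrow> (q has_real_derivative \<sigma> * q' x) (at x)"
    and q': "\<And>x. a < x \<Longrightarrow> x < b \<Longrightarrow> isCont q' x" "\<And>x. a < x \<Longrightarrow> x < b \<Longrightarrow> 0 \<le> q' x"
    and q_less: "\<And>x. a < x \<Longrightarrow> x < b \<Longrightarrow> q x < 1"
    and \<sigma>: "\<bar>\<sigma>\<bar> = 1"
  shows "(\<integral>\<^sup>+x\<in>{a<..<b}. ennreal (q' x / sqrt (1 - q x)) \<partial>lborel) =
    ennreal (\<sigma> * (2 * sqrt (1 - q a) - 2 * sqrt (1 - q b)))"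
proof -
  let ?F = "\<lambda>x. - \<sigma> * (2 * sqrt (1 - q x))"
  have "\<sigma> * \<sigma> = 1"
    using \<sigma> by (metis abs_mult_self_eq mult_1)
  have "(\<integral>\<^sup>+x\<in>{a<..<b}. ennreal (q' x / sqrt (1 - q x)) \<partial>lborel) = ennreal (?F b - ?F a)"
  proof (rule nn_integral_FTC_Ioo[OF \<open>a < b\<close>])
    show "continuous_on {a..b} ?F" by (intro continuous_intros q)
    fix x assume x: "a < x" "x < b"
    show "(?F has_real_derivative q' x / sqrt (1 - q x)) (at x)"
      using q_less[OF x] \<open>\<sigma> * \<sigma> = 1\<close>
      by (auto intro!: derivative_eq_intros deriv[OF x] simp: field_simps)
    show "isCont (\<lambda>x. q' x / sqrt (1 - q x)) x"
      using q_less[OF x] by (intro continuous_intros q'(1)[OF x] DERIV_isCont[OF deriv[OF x]]) auto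
    show "0 \<le> q' x / sqrt (1 - q x)" using q_less[OF x] q'(2)[OF x] by auto
  qed
  then show ?thesis by (simp add: algebra_simps)
qed

lemma sum_weighted_increments_by_parts:
  fixes m x y :: "nat \<Rightarrow> 'a :: comm_ring"
  shows "(\<Sum>i<n. m i * ((x (Suc i) - y (Suc i)) - (x i - y i))) = m n * x n - m 0 * x 0
    - (\<Sum>i<n. x (Suc i) * (m (Suc i) - m i)) - (\<Sum>i<n. m i * (y (Suc i) - y i))"
  by (induction n) (simp_all add: algebra_simps)

definition uniform_grid :: "real \<Rightarrow> real \<Rightarrow> nat \<Rightarrow> nat \<Rightarrow> real" where
  "uniform_grid s r n i = s + real i * (r - s) / real (Suc n)"

lemma uniform_grid_0 [simp]: "uniform_grid s r n 0 = s"
  by (simp add: uniform_grid_def)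

lemma uniform_grid_last [simp]: "uniform_grid s r n (Suc n) = r"
  by (simp add: uniform_grid_def)

lemma uniform_grid_Suc: "uniform_grid s r n (Suc i) = uniform_grid s r n i + (r - s) / real (Suc n)"
  by (simp add: uniform_grid_def distrib_right add_divide_distrib)

lemma uniform_grid_less_Suc: "s < r \<Longrightarrow> uniform_grid s r n i < uniform_grid s r n (Suc i)"
  by (simp add: uniform_grid_Suc)

lemma uniform_grid_ge: "s < r \<Longrightarrow> s \<le> uniform_grid s r n i"
  by (simp add: uniform_grid_def)

lemma uniform_grid_le: "s < r \<Longrightarrow> i \<le> Suc n \<Longrightarrow> uniform_grid s r n i \<le> r"
  using lift_Suc_mono_le[of "uniform_grid s r n" i "Suc n"] uniform_grid_less_Suc[of s r n]
  by (simp add: less_imp_le)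

lemma eventually_uniform_grid_mesh_less:
  assumes "0 < \<delta>"
  shows "\<forall>\<^sub>F n in sequentially. \<forall>i. uniform_grid s r n (Suc i) - uniform_grid s r n i < \<delta>"
proof -
  have "(\<lambda>n. (r - s) * (1 / real (Suc n))) \<longlonglongrightarrow> (r - s) * 0"
    by (intro tendsto_mult tendsto_const LIMSEQ_Suc[OF lim_1_over_n])
  then have "\<forall>\<^sub>F n in sequentially. (r - s) * (1 / real (Suc n)) < \<delta>"
    using assms by (intro order_tendstoD(2)) simp_all
  then show ?thesis by (simp add: uniform_grid_Suc)
qed

lemma sum_integral_uniform_grid:
  fixes f :: "real \<Rightarrow> real"
  assumes "s < r" and f: "f integrable_on {s..r}"
  shows "(\<Sum>i<Suc n. integral {uniform_grid s r n i..uniform_grid s r n (Suc i)} f) = integral {s..r} f"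
proof -
  let ?u = "uniform_grid s r n"
  have increment: "integral {?u i..?u (Suc i)} f = integral {s..?u (Suc i)} f - integral {s..?u i} f"
    if "i < Suc n" for i
  proof -
    have "f integrable_on {s..?u (Suc i)}"
      using that uniform_grid_le[OF \<open>s < r\<close>, of "Suc i" n] by (intro integrable_subinterval_real[OF f]) auto
    then show ?thesis
      using Henstock_Kurzweil_Integration.integral_combine[where a = s and c = "?u i" and b = "?u (Suc i)" and f = f]
        uniform_grid_ge[OF \<open>s < r\<close>, of n i] uniform_grid_less_Suc[OF \<open>s < r\<close>, of n i] by linarith
  qed
  have "(\<Sum>i<Suc n. integral {?u i..?u (Suc i)} f) =
      (\<Sum>i<Suc n. integral {s..?u (Suc i)} f - integral {s..?u i} f)"
    by (intro sum.cong refl increment) simp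
  also have "\<dots> = integral {s..r} f"
    by (subst sum_lessThan_telescope) simp
  finally show ?thesis .
qed

lemma Riemann_Stieltjes_term_error:
  fixes f g g' :: "real \<Rightarrow> real"
  assumes "a \<le> b" and f: "continuous_on {a..b} f" and g': "continuous_on {a..b} g'"
    and g: "\<And>x. x \<in> {a..b} \<Longrightarrow> (g has_real_derivative g' x) (at x within {a..b})"
    and osc: "\<And>x. x \<in> {a..b} \<Longrightarrow> \<bar>y - f x\<bar> \<le> \<eta>" and K: "\<And>x. x \<in> {a..b} \<Longrightarrow> \<bar>g' x\<bar> \<le> K"
  shows "\<bar>y * (g b - g a) - integral {a..b} (\<lambda>x. f x * g' x)\<bar> \<le> \<eta> * K * (b - a)"
proof -
  have "(g' has_integral g b - g a) {a..b}"
    using g \<open>a \<le> b\<close>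
    by (intro fundamental_theorem_of_calculus) (auto simp: has_real_derivative_iff_has_vector_derivative)
  moreover have "(\<lambda>x. f x * g' x) integrable_on {a..b}"
    by (intro integrable_continuous_interval continuous_intros f g')
  ultimately have "((\<lambda>x. y * g' x - f x * g' x) has_integral
      y * (g b - g a) - integral {a..b} (\<lambda>x. f x * g' x)) {a..b}"
    by (intro has_integral_diff has_integral_mult_right integrable_integral)
  then have "y * (g b - g a) - integral {a..b} (\<lambda>x. f x * g' x) = integral {a..b} (\<lambda>x. (y - f x) * g' x)"
    by (simp add: integral_unique left_diff_distrib)
  moreover have "norm (integral {a..b} (\<lambda>x. (y - f x) * g' x)) \<le> \<eta> * K * (b - a)"
  proof (rule integral_bound[OF \<open>a \<le> b\<close>])
    show "continuous_on {a..b} (\<lambda>x. (y - f x) * g' x)" by (intro continuous_intros f g')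
    show "norm ((y - f x) * g' x) \<le> \<eta> * K" if "x \<in> {a..b}" for x
      using osc[OF that] K[OF that] by (auto simp: abs_mult intro!: mult_mono)
  qed
  ultimately show ?thesis by simp
qed

lemma Riemann_Stieltjes_sum_error:
  fixes f g g' :: "real \<Rightarrow> real" and n :: nat
  assumes "s < r" and f: "continuous_on {s..r} f" and g': "continuous_on {s..r} g'"
    and g: "\<And>x. x \<in> {s..r} \<Longrightarrow> (g has_real_derivative g' x) (at x within {s..r})"
    and K: "\<And>x. x \<in> {s..r} \<Longrightarrow> \<bar>g' x\<bar> \<le> K"
  defines "u \<equiv> uniform_grid s r n"
  assumes osc: "\<And>i x. i \<le> n \<Longrightarrow> x \<in> {u i..u (Suc i)} \<Longrightarrow> \<bar>y i - f x\<bar> \<le> \<eta>"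
  shows "\<bar>(\<Sum>i<Suc n. y i * (g (u (Suc i)) - g (u i))) - integral {s..r} (\<lambda>x. f x * g' x)\<bar> \<le> \<eta> * K * (r - s)"
proof -
  let ?err = "\<lambda>i. y i * (g (u (Suc i)) - g (u i)) - integral {u i..u (Suc i)} (\<lambda>x. f x * g' x)"
  have "\<bar>?err i\<bar> \<le> \<eta> * K * (u (Suc i) - u i)" if "i \<in> {..<Suc n}" for i
  proof (rule Riemann_Stieltjes_term_error)
    have "s \<le> u i" "u (Suc i) \<le> r"
      using that \<open>s < r\<close> by (auto simp: u_def intro: uniform_grid_ge uniform_grid_le)
    then have sub: "{u i..u (Suc i)} \<subseteq> {s..r}" by auto
    show "u i \<le> u (Suc i)"
      using uniform_grid_less_Suc[OF \<open>s < r\<close>, of n i] by (simp add: u_def)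
    show "continuous_on {u i..u (Suc i)} f" "continuous_on {u i..u (Suc i)} g'"
      using f g' sub by (auto intro: continuous_on_subset)
    fix x assume x: "x \<in> {u i..u (Suc i)}"
    with sub show "(g has_real_derivative g' x) (at x within {u i..u (Suc i)})" "\<bar>g' x\<bar> \<le> K"
      by (auto intro: DERIV_subset[OF g] K)
    show "\<bar>y i - f x\<bar> \<le> \<eta>" using osc x that by simp
  qed
  then have "\<bar>\<Sum>i<Suc n. ?err i\<bar> \<le> (\<Sum>i<Suc n. \<eta> * K * (u (Suc i) - u i))"
    by (intro order_trans[OF sum_abs] sum_mono)
  also have "\<dots> = \<eta> * K * (r - s)"
    by (simp only: sum_distrib_left[symmetric] sum_lessThan_telescope) (simp add: u_def)
  finally show ?thesis
    using sum_integral_uniform_grid[OF \<open>s < r\<close>, of "\<lambda>x. f x * g' x" n] f g'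
    by (simp only: sum_subtractf u_def integrable_continuous_interval continuous_on_mult)
qed

lemma LIMSEQ_Riemann_Stieltjes_sums:
  fixes f g g' :: "real \<Rightarrow> real"
  assumes "s < r" and f: "continuous_on {s..r} f" and g': "continuous_on {s..r} g'"
    and g: "\<And>x. x \<in> {s..r} \<Longrightarrow> (g has_real_derivative g' x) (at x within {s..r})"
  defines "u \<equiv> uniform_grid s r"
  assumes tag: "\<And>n i. i \<le> n \<Longrightarrow> \<xi> n i \<in> {u n i..u n (Suc i)}"
  shows "(\<lambda>n. \<Sum>i<Suc n. f (\<xi> n i) * (g (u n (Suc i)) - g (u n i))) \<longlonglongrightarrow> integral {s..r} (\<lambda>x. f x * g' x)"
proof (rule tendstoI)
  fix e :: real assume "0 < e"
  have "bounded (g' ` {s..r})"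
    by (intro compact_imp_bounded compact_continuous_image g') simp
  then obtain K where "0 < K" and K: "\<And>x. x \<in> {s..r} \<Longrightarrow> \<bar>g' x\<bar> \<le> K"
    unfolding bounded_pos by auto
  define \<eta> where "\<eta> = e / (2 * K * (r - s))"
  have "0 < \<eta>" using \<open>0 < e\<close> \<open>0 < K\<close> \<open>s < r\<close> by (simp add: \<eta>_def)
  moreover have "uniformly_continuous_on {s..r} f"
    by (intro compact_uniformly_continuous f) simp
  ultimately obtain \<delta> where "0 < \<delta>"
    and \<delta>: "\<And>x y. x \<in> {s..r} \<Longrightarrow> y \<in> {s..r} \<Longrightarrow> \<bar>y - x\<bar> < \<delta> \<Longrightarrow> \<bar>f y - f x\<bar> < \<eta>"
    unfolding uniformly_continuous_on_def dist_real_def by metis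
  show "\<forall>\<^sub>F n in sequentially. dist (\<Sum>i<Suc n. f (\<xi> n i) * (g (u n (Suc i)) - g (u n i)))
      (integral {s..r} (\<lambda>x. f x * g' x)) < e"
    using eventually_uniform_grid_mesh_less[OF \<open>0 < \<delta>\<close>, of s r]
  proof eventually_elim
    case (elim n)
    have "\<bar>f (\<xi> n i) - f x\<bar> \<le> \<eta>" if "i \<le> n" "x \<in> {u n i..u n (Suc i)}" for i x
    proof -
      have "\<bar>\<xi> n i - x\<bar> \<le> u n (Suc i) - u n i" using that tag[of i n] by auto
      also have "\<dots> < \<delta>" using elim by (simp add: u_def)
      finally show ?thesis
        using \<delta>[of x "\<xi> n i"] that tag[of i n] uniform_grid_ge[OF \<open>s < r\<close>, of n i]
          uniform_grid_le[OF \<open>s < r\<close>, of "Suc i" n] by (auto simp: u_def)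
    qed
    then have "\<bar>(\<Sum>i<Suc n. f (\<xi> n i) * (g (u n (Suc i)) - g (u n i))) - integral {s..r} (\<lambda>x. f x * g' x)\<bar>
        \<le> \<eta> * K * (r - s)"
      unfolding u_def by (intro Riemann_Stieltjes_sum_error \<open>s < r\<close> f g' g K)
    also have "\<dots> = e / 2" using \<open>s < r\<close> \<open>0 < K\<close> by (simp add: \<eta>_def field_simps)
    also have "\<dots> < e" using \<open>0 < e\<close> by simp
    finally show ?case by (simp only: dist_real_def)
  qed
qed

lemma LIMSEQ_Riemann_Stieltjes_sums_by_parts:
  fixes m m' x y y' :: "real \<Rightarrow> real"
  assumes "s < r" and x: "continuous_on {s..r} x"
    and m': "continuous_on {s..r} m'" and y': "continuous_on {s..r} y'"
    and m: "\<And>v. v \<in> {s..r} \<Longrightarrow> (m has_real_derivative m' v) (at v within {s..r})"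
    and y: "\<And>v. v \<in> {s..r} \<Longrightarrow> (y has_real_derivative y' v) (at v within {s..r})"
  defines "u \<equiv> uniform_grid s r"
  shows "(\<lambda>n. \<Sum>i<Suc n. m (u n i) * ((x (u n (Suc i)) - y (u n (Suc i))) - (x (u n i) - y (u n i)))) \<longlonglongrightarrow>
    m r * x r - m s * x s - integral {s..r} (\<lambda>v. x v * m' v) - integral {s..r} (\<lambda>v. m v * y' v)"
proof -
  have grid: "u n 0 = s" "u n (Suc n) = r" "u n i \<le> u n (Suc i)" for n i
    using uniform_grid_less_Suc[OF \<open>s < r\<close>, of n i] by (simp_all add: u_def)
  have "continuous_on {s..r} m" by (rule DERIV_continuous_on[OF m])
  then have "(\<lambda>n. \<Sum>i<Suc n. m (u n i) * (y (u n (Suc i)) - y (u n i))) \<longlonglongrightarrow> integral {s..r} (\<lambda>v. m v * y' v)"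
    unfolding u_def using grid(3)
    by (intro LIMSEQ_Riemann_Stieltjes_sums \<open>s < r\<close> y' y) (auto simp: u_def)
  moreover have "(\<lambda>n. \<Sum>i<Suc n. x (u n (Suc i)) * (m (u n (Suc i)) - m (u n i))) \<longlonglongrightarrow>
      integral {s..r} (\<lambda>v. x v * m' v)"
    unfolding u_def using grid(3)
    by (intro LIMSEQ_Riemann_Stieltjes_sums \<open>s < r\<close> x m' m) (auto simp: u_def)
  ultimately show ?thesis
    unfolding sum_weighted_increments_by_parts[of "\<lambda>i. m (u _ i)" "\<lambda>i. x (u _ i)" "\<lambda>i. y (u _ i)"] grid(1,2)
    by (intro tendsto_diff tendsto_const)
qed

lemma inverse_sqrt_diff_le:
  fixes q a\<^sub>0 a :: real
  assumes q: "0 \<le> q" "q < 1" and "0 < a\<^sub>0" "a\<^sub>0 \<le> a"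
  shows "1 / sqrt (a - q * a\<^sub>0) \<le> 1 / sqrt a + q / sqrt (1 - q) / sqrt a\<^sub>0"
proof -
  define y where "y = sqrt (a - q * a\<^sub>0)"
  have "q * a\<^sub>0 < a\<^sub>0" "0 \<le> q * a\<^sub>0" using assms by auto
  then have "q * a\<^sub>0 < a" using \<open>a\<^sub>0 \<le> a\<close> by linarith
  then have y: "0 < y" "y\<^sup>2 = a - q * a\<^sub>0" and "0 < sqrt a" "(sqrt a)\<^sup>2 = a"
    using assms by (auto simp: y_def)
  then have "0 < sqrt a + y" by (intro add_pos_pos)
  have "q * a\<^sub>0 = (sqrt a - y) * (sqrt a + y)"
    using y(2) \<open>(sqrt a)\<^sup>2 = a\<close> by (simp add: power2_eq_square algebra_simps)
  then have "1 / y - 1 / sqrt a = q * a\<^sub>0 / (sqrt a * y * (sqrt a + y))"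
    using y(1) \<open>0 < sqrt a\<close> \<open>0 < sqrt a + y\<close> by (simp add: diff_frac_eq mult.commute)
  also have "\<dots> \<le> q * a\<^sub>0 / (sqrt a * y * sqrt a)"
    using y(1) \<open>0 < sqrt a\<close> \<open>0 < sqrt a + y\<close> \<open>0 \<le> q * a\<^sub>0\<close>
    by (intro divide_left_mono mult_pos_pos mult_left_mono) auto
  also have "\<dots> = q * a\<^sub>0 / (a * y)" using \<open>(sqrt a)\<^sup>2 = a\<close> by (simp add: power2_eq_square ac_simps)
  also have "\<dots> \<le> q * a\<^sub>0 / (a\<^sub>0 * sqrt ((1 - q) * a\<^sub>0))"
    using assms \<open>0 < y\<close> unfolding y_def by (intro divide_left_mono mult_mono) (auto simp: left_diff_distrib)
  also have "\<dots> = q / sqrt (1 - q) / sqrt a\<^sub>0"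
    using \<open>0 < a\<^sub>0\<close> by (simp add: real_sqrt_mult)
  finally show ?thesis by (simp add: y_def)
qed

lemma inverse_sqrt_mult_le:
  fixes v w :: real
  assumes "0 < v" "0 < w"
  shows "1 / sqrt (v * w) \<le> (1 / v + 1 / w) / 2"
  using arith_geo_mean_sqrt[of "1 / v" "1 / w"] assms by (simp add: real_sqrt_divide real_sqrt_mult)

lemma continuous_positive_imp_bounded_below:
  fixes f :: "real \<Rightarrow> real"
  assumes cont: "continuous_on {a..} f" and pos: "\<And>t. a \<le> t \<Longrightarrow> 0 < f t"
    and far: "0 < d" "\<forall>\<^sub>F t in at_top. d \<le> f t"
  obtains c where "0 < c" "\<And>t. a \<le> t \<Longrightarrow> c \<le> f t"
proof -
  obtain T where T: "a \<le> T" "\<And>t. T \<le> t \<Longrightarrow> d \<le> f t"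
    using far(2) unfolding eventually_at_top_linorder by (metis max.bounded_iff max.cobounded1)
  have "\<exists>x\<in>{a..T}. \<forall>y\<in>{a..T}. f x \<le> f y"
    using T(1) by (intro continuous_attains_inf continuous_on_subset[OF cont]) auto
  then obtain x where x: "x \<in> {a..T}" "\<And>y. y \<in> {a..T} \<Longrightarrow> f x \<le> f y" by blast
  show thesis
  proof (rule that[of "min (f x) d"])
    show "0 < min (f x) d" using pos[of x] x(1) \<open>0 < d\<close> by auto
    show "min (f x) d \<le> f t" if "a \<le> t" for t
      using x(2)[of t] T(2)[of t] that by (cases "t \<le> T") auto
  qed
qed

lemma eventually_ge_of_powr_le:
  fixes f :: "real \<Rightarrow> real"
  assumes "0 \<le> \<rho>" "0 \<le> C" and le: "\<And>t. t\<^sub>0 \<le> t \<Longrightarrow> C * t powr \<rho> \<le> f t"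
  shows "\<forall>\<^sub>F t in at_top. C \<le> f t"
  using eventually_ge_at_top[of t\<^sub>0] eventually_ge_at_top[of 1]
proof eventually_elim
  case (elim t)
  then have "C * 1 \<le> C * t powr \<rho>"
    using assms by (intro mult_left_mono ge_one_powr_ge_zero) auto
  with le[OF elim(1)] show ?case by simp
qed

section \<open>Measurability, moments and tail bounds\<close>

lemma measurable_continuous_paths:
  fixes X :: "real \<Rightarrow> 'a \<Rightarrow> 'b :: metric_space"
  assumes X: "\<And>t. X t \<in> borel_measurable M" and cont: "\<And>\<omega>. continuous_on UNIV (\<lambda>t. X t \<omega>)"
  shows "(\<lambda>(t, \<omega>). X t \<omega>) \<in> borel_measurable (borel \<Otimes>\<^sub>M M)"
proof (rule borel_measurable_LIMSEQ_metric)
  let ?a = "\<lambda>n t. real_of_int \<lfloor>t * real (Suc n)\<rfloor> / real (Suc n)"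
  show "(\<lambda>z. X (?a n (fst z)) (snd z)) \<in> borel_measurable (borel \<Otimes>\<^sub>M M)" for n
  proof -
    have "(\<lambda>z. X (real_of_int i / real (Suc n)) (snd z)) \<in> borel_measurable (borel \<Otimes>\<^sub>M M)" for i
      by (rule measurable_compose[OF measurable_snd X])
    moreover have "(\<lambda>z. \<lfloor>fst z * real (Suc n)\<rfloor>) \<in> borel \<Otimes>\<^sub>M M \<rightarrow>\<^sub>M count_space UNIV"
      by measurable
    ultimately show ?thesis by (rule measurable_compose_countable)
  qed
  show "(\<lambda>n. X (?a n (fst z)) (snd z)) \<longlonglongrightarrow> (case z of (t, \<omega>) \<Rightarrow> X t \<omega>)" for z
  proof -
    have "norm (?a n (fst z) - fst z) \<le> 1 / real (Suc n)" for n
    proof -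
      have "?a n (fst z) - fst z = (real_of_int \<lfloor>fst z * real (Suc n)\<rfloor> - fst z * real (Suc n)) / real (Suc n)"
        by (simp add: diff_divide_distrib)
      also have "norm \<dots> \<le> 1 / real (Suc n)"
        unfolding real_norm_def abs_divide by (rule frac_le) (simp, linarith, simp_all)
      finally show ?thesis .
    qed
    then have "(\<lambda>n. ?a n (fst z) - fst z) \<longlonglongrightarrow> 0"
      by (intro Lim_null_comparison[OF always_eventually LIMSEQ_Suc[OF lim_1_over_n]] allI)
    then have "(\<lambda>n. ?a n (fst z)) \<longlonglongrightarrow> fst z"
      by (rule LIM_zero_cancel)
    then show ?thesis
      using cont[of "snd z"]
      by (auto simp: continuous_on_eq_continuous_at case_prod_unfold intro: isCont_tendsto_compose)
  qed
qed

lemma (in pair_sigma_finite) nn_integral_power2_nn_integral: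
  assumes [measurable]: "case_prod g \<in> borel_measurable (M1 \<Otimes>\<^sub>M M2)"
  shows "(\<integral>\<^sup>+\<omega>. (\<integral>\<^sup>+s. g s \<omega> \<partial>M1)\<^sup>2 \<partial>M2) = (\<integral>\<^sup>+s. \<integral>\<^sup>+r. \<integral>\<^sup>+\<omega>. g s \<omega> * g r \<omega> \<partial>M2 \<partial>M1 \<partial>M1)"
proof -
  have "(\<integral>\<^sup>+\<omega>. (\<integral>\<^sup>+s. g s \<omega> \<partial>M1)\<^sup>2 \<partial>M2) = (\<integral>\<^sup>+\<omega>. \<integral>\<^sup>+s. \<integral>\<^sup>+r. g s \<omega> * g r \<omega> \<partial>M1 \<partial>M1 \<partial>M2)"
  proof (rule nn_integral_cong)
    fix \<omega> assume [measurable]: "\<omega> \<in> space M2"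
    have "(\<integral>\<^sup>+s. g s \<omega> \<partial>M1)\<^sup>2 = (\<integral>\<^sup>+s. g s \<omega> * (\<integral>\<^sup>+r. g r \<omega> \<partial>M1) \<partial>M1)"
      unfolding power2_eq_square by (rule nn_integral_multc[symmetric]) measurable
    also have "\<dots> = (\<integral>\<^sup>+s. \<integral>\<^sup>+r. g s \<omega> * g r \<omega> \<partial>M1 \<partial>M1)"
      by (intro nn_integral_cong nn_integral_cmult[symmetric]) measurable
    finally show "(\<integral>\<^sup>+s. g s \<omega> \<partial>M1)\<^sup>2 = (\<integral>\<^sup>+s. \<integral>\<^sup>+r. g s \<omega> * g r \<omega> \<partial>M1 \<partial>M1)" .
  qed
  also have "\<dots> = (\<integral>\<^sup>+s. \<integral>\<^sup>+\<omega>. \<integral>\<^sup>+r. g s \<omega> * g r \<omega> \<partial>M1 \<partial>M2 \<partial>M1)"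
    by (rule Fubini') measurable
  also have "\<dots> = (\<integral>\<^sup>+s. \<integral>\<^sup>+r. \<integral>\<^sup>+\<omega>. g s \<omega> * g r \<omega> \<partial>M2 \<partial>M1 \<partial>M1)"
    by (intro nn_integral_cong Fubini') measurable
  finally show ?thesis .
qed

lemma (in sigma_finite_measure) nn_integral_product_plus_symmetrization:
  fixes m :: "'a \<Rightarrow> ennreal"
  assumes [measurable]: "m \<in> borel_measurable M" "case_prod k \<in> borel_measurable (M \<Otimes>\<^sub>M M)" "A \<in> sets M"
  shows "(\<integral>\<^sup>+s\<in>A. (\<integral>\<^sup>+r\<in>A. m s * m r + (k s r + k r s) \<partial>M) \<partial>M) =
    (\<integral>\<^sup>+s\<in>A. m s \<partial>M)\<^sup>2 + 2 * (\<integral>\<^sup>+s\<in>A. (\<integral>\<^sup>+r\<in>A. k s r \<partial>M) \<partial>M)"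
proof -
  interpret P: pair_sigma_finite M M ..
  define m' where "m' r = m r * indicator A r" for r
  define k' where "k' s r = k s r * indicator A r * indicator A s" for s r
  have [measurable]: "m' \<in> borel_measurable M" "case_prod k' \<in> borel_measurable (M \<Otimes>\<^sub>M M)"
    unfolding m'_def k'_def by measurable
  have "(\<integral>\<^sup>+s\<in>A. (\<integral>\<^sup>+r\<in>A. m s * m r + (k s r + k r s) \<partial>M) \<partial>M) =
      (\<integral>\<^sup>+s. \<integral>\<^sup>+r. m' s * m' r + (k' s r + k' r s) \<partial>M \<partial>M)"
    by (intro nn_integral_cong) (auto simp: m'_def k'_def split: split_indicator intro!: nn_integral_cong)
  also have "\<dots> = (\<integral>\<^sup>+s. \<integral>\<^sup>+r. m' s * m' r \<partial>M \<partial>M) +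
      ((\<integral>\<^sup>+s. \<integral>\<^sup>+r. k' s r \<partial>M \<partial>M) + (\<integral>\<^sup>+s. \<integral>\<^sup>+r. k' r s \<partial>M \<partial>M))"
    by (simp add: nn_integral_add cong: nn_integral_cong)
  also have "(\<integral>\<^sup>+s. \<integral>\<^sup>+r. m' s * m' r \<partial>M \<partial>M) = (\<integral>\<^sup>+s. m' s \<partial>M)\<^sup>2"
    by (simp add: nn_integral_cmult nn_integral_multc power2_eq_square)
  also have "(\<integral>\<^sup>+s. \<integral>\<^sup>+r. k' r s \<partial>M \<partial>M) = (\<integral>\<^sup>+s. \<integral>\<^sup>+r. k' s r \<partial>M \<partial>M)"
    by (rule P.Fubini') measurable
  also have "(\<integral>\<^sup>+s. \<integral>\<^sup>+r. k' s r \<partial>M \<partial>M) = (\<integral>\<^sup>+s\<in>A. (\<integral>\<^sup>+r\<in>A. k s r \<partial>M) \<partial>M)"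
    unfolding k'_def by (intro nn_integral_cong nn_integral_multc) measurable
  finally show ?thesis by (simp add: m'_def mult_2)
qed

lemma nn_integral_lborel_mono_off_diagonal:
  fixes K H :: "real \<Rightarrow> real \<Rightarrow> ennreal"
  assumes le: "\<And>s r. a < s \<Longrightarrow> s \<le> b \<Longrightarrow> a < r \<Longrightarrow> r \<le> b \<Longrightarrow> s \<noteq> r \<Longrightarrow> K s r \<le> H s r"
  shows "(\<integral>\<^sup>+s\<in>{a..b}. (\<integral>\<^sup>+r\<in>{a..b}. K s r \<partial>lborel) \<partial>lborel) \<le>
    (\<integral>\<^sup>+s\<in>{a..b}. (\<integral>\<^sup>+r\<in>{a..b}. H s r \<partial>lborel) \<partial>lborel)"
proof -
  have inner: "(\<integral>\<^sup>+r\<in>{a..b}. K s r \<partial>lborel) \<le> (\<integral>\<^sup>+r\<in>{a..b}. H s r \<partial>lborel)" if "a < s" "s \<le> b" for s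
  proof (rule nn_integral_mono_AE)
    show "AE r in lborel. K s r * indicator {a..b} r \<le> H s r * indicator {a..b} r"
      using AE_lborel_singleton[of a] AE_lborel_singleton[of s]
      by eventually_elim (use le[of s] that in \<open>auto split: split_indicator\<close>)
  qed
  show ?thesis
  proof (rule nn_integral_mono_AE)
    show "AE s in lborel. (\<integral>\<^sup>+r\<in>{a..b}. K s r \<partial>lborel) * indicator {a..b} s \<le>
        (\<integral>\<^sup>+r\<in>{a..b}. H s r \<partial>lborel) * indicator {a..b} s"
      using AE_lborel_singleton[of a] by eventually_elim (use inner in \<open>auto split: split_indicator\<close>)
  qed
qed

lemma (in prob_space) prob_le_half_mean:
  fixes Z :: "'a \<Rightarrow> real"
  assumes [measurable]: "Z \<in> borel_measurable M" and nonneg: "\<And>\<omega>. 0 \<le> Z \<omega>"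
    and mean: "ennreal m \<le> (\<integral>\<^sup>+\<omega>. ennreal (Z \<omega>) \<partial>M)" "(\<integral>\<^sup>+\<omega>. ennreal (Z \<omega>) \<partial>M) < \<infinity>" "0 < m"
    and square: "(\<integral>\<^sup>+\<omega>. (ennreal (Z \<omega>))\<^sup>2 \<partial>M) \<le> (\<integral>\<^sup>+\<omega>. ennreal (Z \<omega>) \<partial>M)\<^sup>2 + ennreal v" "0 \<le> v"
  shows "prob {\<omega> \<in> space M. Z \<omega> \<le> m / 2} \<le> 4 * v / m\<^sup>2"
proof -
  have int: "integrable M Z"
    using nonneg mean by (intro integrableI_nonneg) auto
  then have E: "(\<integral>\<^sup>+\<omega>. ennreal (Z \<omega>) \<partial>M) = ennreal (expectation Z)"
    using nonneg by (intro nn_integral_eq_integral) auto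
  have E_nonneg: "0 \<le> expectation Z" using nonneg by (intro Bochner_Integration.integral_nonneg) auto
  have m_le: "m \<le> expectation Z" using mean(1) E_nonneg by (simp add: E)
  have sq: "(\<integral>\<^sup>+\<omega>. ennreal ((Z \<omega>)\<^sup>2) \<partial>M) \<le> ennreal ((expectation Z)\<^sup>2 + v)"
    using square nonneg E_nonneg by (simp add: E ennreal_power)
  then have int2: "integrable M (\<lambda>\<omega>. (Z \<omega>)\<^sup>2)"
    by (intro integrableI_nonneg) (auto intro: order.strict_trans1 ennreal_less_top)
  then have "expectation (\<lambda>\<omega>. (Z \<omega>)\<^sup>2) \<le> (expectation Z)\<^sup>2 + v"
    using sq \<open>0 \<le> v\<close> by (subst (asm) nn_integral_eq_integral) (auto simp del: ennreal_plus)
  then have var: "variance Z \<le> v" using int int2 by (simp add: variance_eq)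
  have "prob {\<omega> \<in> space M. Z \<omega> \<le> m / 2} \<le> prob {\<omega> \<in> space M. m / 2 \<le> \<bar>Z \<omega> - expectation Z\<bar>}"
  proof (rule finite_measure_mono)
    have "m / 2 \<le> \<bar>Z \<omega> - expectation Z\<bar>" if "Z \<omega> \<le> m / 2" for \<omega>
      using that m_le by linarith
    then show "{\<omega> \<in> space M. Z \<omega> \<le> m / 2} \<subseteq> {\<omega> \<in> space M. m / 2 \<le> \<bar>Z \<omega> - expectation Z\<bar>}"
      by blast
  qed measurable
  also have "\<dots> \<le> variance Z / (m / 2)\<^sup>2"
    using int2 \<open>0 < m\<close> by (intro Chebyshev_inequality) auto
  also have "\<dots> \<le> v / (m / 2)\<^sup>2"
    using var by (intro divide_right_mono) auto
  also have "\<dots> = 4 * v / m\<^sup>2" by (simp add: power_divide)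
  finally show ?thesis .
qed

lemma emeasure_le_add_L2_distance:
  fixes Z L :: "'a \<Rightarrow> real"
  assumes [measurable]: "Z \<in> borel_measurable M" "L \<in> borel_measurable M" and "b < a"
  shows "emeasure M {\<omega> \<in> space M. L \<omega> \<le> b} \<le> emeasure M {\<omega> \<in> space M. Z \<omega> \<le> a} +
    ennreal (1 / (a - b)\<^sup>2) * (\<integral>\<^sup>+\<omega>. ennreal ((Z \<omega> - L \<omega>)\<^sup>2) \<partial>M)"
proof -
  define c where "c = ennreal (1 / (a - b)\<^sup>2)"
  let ?far = "{\<omega> \<in> space M. 1 \<le> c * ennreal ((Z \<omega> - L \<omega>)\<^sup>2)}"
  have "Z \<omega> \<le> a \<or> 1 \<le> c * ennreal ((Z \<omega> - L \<omega>)\<^sup>2)" if "L \<omega> \<le> b" for \<omega>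
  proof (cases "Z \<omega> \<le> a")
    case False
    then have "(a - b)\<^sup>2 \<le> (Z \<omega> - L \<omega>)\<^sup>2" using that \<open>b < a\<close> by (intro power_mono) auto
    then have "1 \<le> 1 / (a - b)\<^sup>2 * (Z \<omega> - L \<omega>)\<^sup>2" using \<open>b < a\<close> by simp
    then show ?thesis by (simp add: c_def ennreal_mult[symmetric])
  qed simp
  then have "{\<omega> \<in> space M. L \<omega> \<le> b} \<subseteq> {\<omega> \<in> space M. Z \<omega> \<le> a} \<union> ?far"
    by blast
  then have "emeasure M {\<omega> \<in> space M. L \<omega> \<le> b} \<le> emeasure M ({\<omega> \<in> space M. Z \<omega> \<le> a} \<union> ?far)"
    by (rule emeasure_mono) measurable
  also have "\<dots> \<le> emeasure M {\<omega> \<in> space M. Z \<omega> \<le> a} + emeasure M ?far"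
    by (rule emeasure_subadditive) measurable
  also have "emeasure M ?far \<le> c * (\<integral>\<^sup>+\<omega>\<in>space M. ennreal ((Z \<omega> - L \<omega>)\<^sup>2) \<partial>M)"
    by (rule nn_integral_Markov_inequality) measurable
  also have "(\<integral>\<^sup>+\<omega>\<in>space M. ennreal ((Z \<omega> - L \<omega>)\<^sup>2) \<partial>M) = (\<integral>\<^sup>+\<omega>. ennreal ((Z \<omega> - L \<omega>)\<^sup>2) \<partial>M)"
    by (rule nn_integral_cong) simp
  finally show ?thesis by (simp add: c_def add_left_mono)
qed

lemma emeasure_le_of_L2_limit:
  fixes Z :: "'i \<Rightarrow> 'a \<Rightarrow> real"
  assumes L: "L \<in> borel_measurable M"
    and Z: "\<forall>\<^sub>F i in I. Z i \<in> borel_measurable M \<and> emeasure M {\<omega> \<in> space M. Z i \<omega> \<le> a} \<le> p"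
    and lim: "((\<lambda>i. \<integral>\<^sup>+\<omega>. ennreal ((Z i \<omega> - L \<omega>)\<^sup>2) \<partial>M) \<longlongrightarrow> 0) I"
    and "b < a" "I \<noteq> bot"
  shows "emeasure M {\<omega> \<in> space M. L \<omega> \<le> b} \<le> p"
proof -
  define c where "c = ennreal (1 / (a - b)\<^sup>2)"
  let ?d = "\<lambda>i. \<integral>\<^sup>+\<omega>. ennreal ((Z i \<omega> - L \<omega>)\<^sup>2) \<partial>M"
  have "\<forall>\<^sub>F i in I. emeasure M {\<omega> \<in> space M. L \<omega> \<le> b} \<le> p + c * ?d i"
    using Z
  proof eventually_elim
    case (elim i)
    then have "emeasure M {\<omega> \<in> space M. L \<omega> \<le> b} \<le> emeasure M {\<omega> \<in> space M. Z i \<omega> \<le> a} + c * ?d i"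
      unfolding c_def using L \<open>b < a\<close> by (intro emeasure_le_add_L2_distance) auto
    also have "\<dots> \<le> p + c * ?d i" using elim by (intro add_right_mono) simp
    finally show ?case .
  qed
  moreover have "((\<lambda>i. p + c * ?d i) \<longlongrightarrow> p + c * 0) I"
    by (intro tendsto_add tendsto_const ennreal_tendsto_cmult lim) (simp add: c_def)
  ultimately show ?thesis
    using tendsto_lowerbound \<open>I \<noteq> bot\<close> by fastforce
qed

lemma mono_on_unbounded_imp_filterlim_at_top:
  fixes f :: "real \<Rightarrow> 'a :: linorder"
  assumes mono: "mono_on {a..} f" and unbounded: "\<And>z. \<exists>t\<ge>a. z \<le> f t"
  shows "filterlim f at_top at_top"
  unfolding filterlim_at_top
proof
  fix z
  obtain t where t: "a \<le> t" "z \<le> f t" using unbounded by blast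
  show "\<forall>\<^sub>F u in at_top. z \<le> f u"
    using eventually_ge_at_top[of t]
  proof eventually_elim
    case (elim u)
    then have "f t \<le> f u" using mono t(1) by (auto intro: mono_onD)
    with t(2) show ?case by (rule order_trans)
  qed
qed

lemma AE_filterlim_at_top_of_tendsto_in_measure:
  fixes L :: "real \<Rightarrow> 'a \<Rightarrow> real"
  assumes L [measurable]: "\<And>t. 0 \<le> t \<Longrightarrow> L t \<in> borel_measurable M"
    and mono: "AE \<omega> in M. mono_on {0..} (\<lambda>t. L t \<omega>)"
    and lim: "\<And>z. ((\<lambda>t. emeasure M {\<omega> \<in> space M. L t \<omega> \<le> z}) \<longlongrightarrow> 0) at_top"
  shows "AE \<omega> in M. filterlim (\<lambda>t. L t \<omega>) at_top at_top"
proof -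
  have "AE \<omega> in M. \<exists>n. real k < L (real n) \<omega>" for k :: nat
  proof (rule AE_I)
    let ?N = "{\<omega> \<in> space M. \<forall>n. L (real n) \<omega> \<le> real k}"
    show "{\<omega> \<in> space M. \<not> (\<exists>n. real k < L (real n) \<omega>)} \<subseteq> ?N" by (auto simp: not_less)
    show "?N \<in> sets M" by measurable
    have "emeasure M ?N \<le> emeasure M {\<omega> \<in> space M. L (real n) \<omega> \<le> real k}" for n
      by (rule emeasure_mono) auto
    moreover have "(\<lambda>n. emeasure M {\<omega> \<in> space M. L (real n) \<omega> \<le> real k}) \<longlonglongrightarrow> 0"
      using lim filterlim_real_sequentially by (rule filterlim_compose)
    ultimately have "emeasure M ?N \<le> 0"
      by (intro LIMSEQ_le_const) auto
    then show "emeasure M ?N = 0" by simp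
  qed
  then have "AE \<omega> in M. \<forall>k::nat. \<exists>n. real k < L (real n) \<omega>"
    by (simp add: AE_all_countable)
  then show ?thesis
    using mono
  proof eventually_elim
    case (elim \<omega>)
    show ?case
    proof (rule mono_on_unbounded_imp_filterlim_at_top[OF elim(2)])
      fix z :: real
      obtain k :: nat where "z \<le> real k" using real_arch_simple by blast
      moreover obtain n where "real k < L (real n) \<omega>" using elim(1) by blast
      ultimately show "\<exists>t\<ge>0. z \<le> L t \<omega>" by (intro exI[of _ "real n"]) simp
    qed
  qed
qed

section \<open>Heat kernels and Gaussian innovations\<close>

lemma heat_kernel_eq_normal_density: "0 \<le> \<epsilon> \<Longrightarrow> heat_kernel \<epsilon> y = normal_density 0 (sqrt \<epsilon>) y"
  by (simp add: heat_kernel_def normal_density_def)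

lemma heat_kernel_nonneg: "0 \<le> \<epsilon> \<Longrightarrow> 0 \<le> heat_kernel \<epsilon> y"
  by (simp add: heat_kernel_def)

lemma heat_kernel_minus: "heat_kernel \<epsilon> (- y) = heat_kernel \<epsilon> y"
  by (simp add: heat_kernel_def)

lemma heat_kernel_le_heat_kernel_0:
  assumes "0 < \<delta>" "\<delta> \<le> \<epsilon>"
  shows "heat_kernel \<epsilon> y \<le> heat_kernel \<delta> 0"
proof -
  have "heat_kernel \<epsilon> y \<le> 1 / sqrt (2 * pi * \<epsilon>)"
    unfolding heat_kernel_def using assms by (intro mult_left_le) auto
  also have "\<dots> \<le> heat_kernel \<delta> 0"
    using assms by (auto simp: heat_kernel_def intro!: divide_left_mono)
  finally show ?thesis .
qed

lemma heat_kernel_measurable [measurable]: "heat_kernel \<epsilon> \<in> borel_measurable borel"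
  unfolding heat_kernel_def[abs_def] by measurable

lemma tendsto_heat_kernel:
  assumes "(v \<longlongrightarrow> w) I" "(y \<longlongrightarrow> z) I" "0 < w"
  shows "((\<lambda>i. heat_kernel (v i) (y i)) \<longlongrightarrow> heat_kernel w z) I"
  unfolding heat_kernel_def using assms by (intro tendsto_intros) auto

lemma continuous_on_heat_kernel:
  "0 < \<epsilon> \<Longrightarrow> continuous_on S f \<Longrightarrow> continuous_on S (\<lambda>t. heat_kernel \<epsilon> (f t))"
  unfolding heat_kernel_def by (intro continuous_intros) auto

lemma heat_kernel_0_mult: "heat_kernel a 0 * heat_kernel b 0 = 1 / (2 * pi * sqrt (a * b))"
proof -
  have "sqrt (2 * pi * a) * sqrt (2 * pi * b) = sqrt ((2 * pi)\<^sup>2 * (a * b))"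
    by (simp add: real_sqrt_mult[symmetric] power2_eq_square ac_simps)
  also have "\<dots> = 2 * pi * sqrt (a * b)"
    by (simp only: real_sqrt_mult real_sqrt_abs) simp
  finally show ?thesis by (simp add: heat_kernel_def)
qed

lemma heat_kernel_scale:
  assumes "\<kappa> \<noteq> 0"
  shows "heat_kernel \<epsilon> (\<kappa> * y) = heat_kernel (\<epsilon> / \<kappa>\<^sup>2) y / \<bar>\<kappa>\<bar>"
proof -
  have "sqrt (2 * pi * \<epsilon>) = \<bar>\<kappa>\<bar> * sqrt (2 * pi * (\<epsilon> / \<kappa>\<^sup>2))"
    using assms by (simp add: real_sqrt_mult real_sqrt_divide)
  moreover have "- (\<kappa> * y)\<^sup>2 / (2 * \<epsilon>) = - y\<^sup>2 / (2 * (\<epsilon> / \<kappa>\<^sup>2))"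
    by (simp add: power_mult_distrib)
  ultimately show ?thesis by (simp only: heat_kernel_def) simp
qed

lemma heat_kernel_mult:
  assumes "0 < \<epsilon>" "0 < w"
  shows "heat_kernel \<epsilon> y * heat_kernel w (\<kappa> * y) =
    heat_kernel (w + \<kappa>\<^sup>2 * \<epsilon>) 0 * heat_kernel (\<epsilon> * w / (w + \<kappa>\<^sup>2 * \<epsilon>)) y"
proof -
  define h where "h = \<epsilon> * w / (w + \<kappa>\<^sup>2 * \<epsilon>)"
  have pos: "0 < w + \<kappa>\<^sup>2 * \<epsilon>" using assms by (auto intro!: add_pos_nonneg)
  have "- y\<^sup>2 / (2 * \<epsilon>) + - (\<kappa> * y)\<^sup>2 / (2 * w) = - y\<^sup>2 / (2 * h)"
    using assms pos by (simp add: h_def field_simps)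
  moreover have "sqrt (2 * pi * \<epsilon>) * sqrt (2 * pi * w) = sqrt (2 * pi * (w + \<kappa>\<^sup>2 * \<epsilon>)) * sqrt (2 * pi * h)"
    using pos by (simp add: h_def real_sqrt_mult[symmetric] field_simps)
  ultimately show ?thesis
    unfolding h_def[symmetric] heat_kernel_def by (simp add: exp_add[symmetric] mult.assoc)
qed

lemma nn_integral_heat_kernel_normal:
  assumes "0 < \<epsilon>" "0 < \<sigma>"
  shows "(\<integral>\<^sup>+y. ennreal (heat_kernel \<epsilon> (b + y)) \<partial>density lborel (normal_density 0 \<sigma>)) =
    ennreal (heat_kernel (\<epsilon> + \<sigma>\<^sup>2) b)"
proof -
  have "heat_kernel \<epsilon> (b + y) = normal_density 0 (sqrt \<epsilon>) (- b - y)" for y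
    using assms heat_kernel_minus[of \<epsilon> "b + y"] by (simp add: heat_kernel_eq_normal_density)
  then have "(\<integral>\<^sup>+y. ennreal (heat_kernel \<epsilon> (b + y)) \<partial>density lborel (normal_density 0 \<sigma>)) =
      (\<integral>\<^sup>+y. ennreal (normal_density 0 (sqrt \<epsilon>) (- b - y) * normal_density 0 \<sigma> y) \<partial>lborel)"
    by (simp add: nn_integral_density ennreal_mult mult.commute)
  also have "\<dots> = ennreal (normal_density 0 (sqrt ((sqrt \<epsilon>)\<^sup>2 + \<sigma>\<^sup>2)) (- b))"
    using conv_normal_density_zero_mean[of "sqrt \<epsilon>" \<sigma>] assms by (simp add: fun_eq_iff)
  also have "\<dots> = ennreal (heat_kernel (\<epsilon> + \<sigma>\<^sup>2) b)"
    using assms heat_kernel_minus[of "\<epsilon> + \<sigma>\<^sup>2" b] by (simp add: heat_kernel_eq_normal_density)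
  finally show ?thesis .
qed

lemma LIMSEQ_nn_integral_heat_kernel:
  fixes f :: "'a \<Rightarrow> ennreal" and Y :: "nat \<Rightarrow> 'a \<Rightarrow> real"
  assumes [measurable]: "f \<in> borel_measurable M" "\<And>n. Y n \<in> borel_measurable M" "Z \<in> borel_measurable M"
    and fin: "(\<integral>\<^sup>+\<omega>. f \<omega> \<partial>M) < \<infinity>" and "0 < \<epsilon>"
    and v: "\<And>n. 0 \<le> v n" "v \<longlonglongrightarrow> w" and Y: "AE \<omega> in M. (\<lambda>n. Y n \<omega>) \<longlonglongrightarrow> Z \<omega>"
  shows "(\<lambda>n. \<integral>\<^sup>+\<omega>. f \<omega> * ennreal (heat_kernel (\<epsilon> + v n) (Y n \<omega>)) \<partial>M) \<longlonglongrightarrow>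
    (\<integral>\<^sup>+\<omega>. f \<omega> * ennreal (heat_kernel (\<epsilon> + w) (Z \<omega>)) \<partial>M)"
proof (rule nn_integral_dominated_convergence[where w = "\<lambda>\<omega>. f \<omega> * ennreal (heat_kernel \<epsilon> 0)"])
  have "0 < \<epsilon> + w" using LIMSEQ_le_const[OF v(2), of 0] v(1) \<open>0 < \<epsilon>\<close> by force
  have "AE \<omega> in M. f \<omega> < top"
    using nn_integral_PInf_AE[of f M] fin by (auto simp: top.not_eq_extremum)
  with Y show "AE \<omega> in M. (\<lambda>n. f \<omega> * ennreal (heat_kernel (\<epsilon> + v n) (Y n \<omega>))) \<longlonglongrightarrow>
      f \<omega> * ennreal (heat_kernel (\<epsilon> + w) (Z \<omega>))"
  proof eventually_elim
    case (elim \<omega>)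
    then show ?case
      using \<open>0 < \<epsilon> + w\<close>
      by (intro ennreal_tendsto_cmult tendsto_ennrealI tendsto_heat_kernel tendsto_add tendsto_const v)
  qed
  show "AE \<omega> in M. f \<omega> * ennreal (heat_kernel (\<epsilon> + v n) (Y n \<omega>)) \<le> f \<omega> * ennreal (heat_kernel \<epsilon> 0)" for n
    using v(1)[of n] \<open>0 < \<epsilon>\<close>
    by (intro AE_I2 mult_left_mono ennreal_leI heat_kernel_le_heat_kernel_0) auto
  show "(\<integral>\<^sup>+\<omega>. f \<omega> * ennreal (heat_kernel \<epsilon> 0) \<partial>M) < \<infinity>"
    using fin by (simp add: nn_integral_multc ennreal_mult_less_top)
qed measurable

context prob_space
begin

lemma distr_pair_eq_of_indep_set:
  assumes G: "subalgebra M G" and U: "U \<in> G \<rightarrow>\<^sub>M N" and D [measurable]: "D \<in> M \<rightarrow>\<^sub>M N'"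
    and ind: "indep_set (sets G) (sets (vimage_algebra (space M) D N'))"
  shows "distr M N U \<Otimes>\<^sub>M distr M N' D = distr M (N \<Otimes>\<^sub>M N') (\<lambda>\<omega>. (U \<omega>, D \<omega>))"
proof (rule pair_measure_eqI)
  have [measurable]: "U \<in> M \<rightarrow>\<^sub>M N" by (rule measurable_from_subalg[OF G U])
  show "sigma_finite_measure (distr M N U)" "sigma_finite_measure (distr M N' D)"
    by (auto intro!: prob_space_imp_sigma_finite prob_space_distr)
  fix S T assume S: "S \<in> sets (distr M N U)" and T: "T \<in> sets (distr M N' D)"
  have "U -` S \<inter> space M \<in> sets G"
    using measurable_sets[OF U] S G by (simp add: subalgebra_def)
  moreover have "D -` T \<inter> space M \<in> sets (vimage_algebra (space M) D N')"
    using T by (simp add: in_vimage_algebra)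
  ultimately have "prob ((U -` S \<inter> space M) \<inter> (D -` T \<inter> space M)) =
      prob (U -` S \<inter> space M) * prob (D -` T \<inter> space M)"
    using ind unfolding indep_sets2_eq by blast
  moreover have "(\<lambda>\<omega>. (U \<omega>, D \<omega>)) -` (S \<times> T) \<inter> space M = (U -` S \<inter> space M) \<inter> (D -` T \<inter> space M)"
    by auto
  ultimately show "emeasure (distr M N U) S * emeasure (distr M N' D) T =
      emeasure (distr M (N \<Otimes>\<^sub>M N') (\<lambda>\<omega>. (U \<omega>, D \<omega>))) (S \<times> T)"
    using S T by (simp add: emeasure_distr emeasure_eq_measure ennreal_mult)
qed (simp cong: sets_pair_measure_cong)

text \<open>
  For \<open>v > 0\<close> this characterises the centred normal variables of variance \<open>v\<close> that are independent
  of \<open>G\<close>. Unlike densities, the test against heat kernels passes to limits by dominated convergence,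
  and it covers \<open>v = 0\<close>.
\<close>

definition gaussian_innovation :: "'a measure \<Rightarrow> real \<Rightarrow> ('a \<Rightarrow> real) \<Rightarrow> bool" where
  "gaussian_innovation G v D \<longleftrightarrow> D \<in> borel_measurable M \<and> 0 \<le> v \<and>
    (\<forall>\<epsilon>>0. \<forall>f\<in>borel_measurable G. \<forall>b\<in>borel_measurable G. (\<integral>\<^sup>+\<omega>. f \<omega> \<partial>M) < \<infinity> \<longrightarrow>
      (\<integral>\<^sup>+\<omega>. f \<omega> * ennreal (heat_kernel \<epsilon> (b \<omega> + D \<omega>)) \<partial>M) =
      (\<integral>\<^sup>+\<omega>. f \<omega> * ennreal (heat_kernel (\<epsilon> + v) (b \<omega>)) \<partial>M))"

lemma gaussian_innovationI:
  assumes "D \<in> borel_measurable M" "0 \<le> v"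
    and "\<And>\<epsilon> f b. 0 < \<epsilon> \<Longrightarrow> f \<in> borel_measurable G \<Longrightarrow> b \<in> borel_measurable G \<Longrightarrow> (\<integral>\<^sup>+\<omega>. f \<omega> \<partial>M) < \<infinity> \<Longrightarrow>
      (\<integral>\<^sup>+\<omega>. f \<omega> * ennreal (heat_kernel \<epsilon> (b \<omega> + D \<omega>)) \<partial>M) =
      (\<integral>\<^sup>+\<omega>. f \<omega> * ennreal (heat_kernel (\<epsilon> + v) (b \<omega>)) \<partial>M)"
  shows "gaussian_innovation G v D"
  using assms unfolding gaussian_innovation_def by blast

lemma gaussian_innovation_measurable: "gaussian_innovation G v D \<Longrightarrow> D \<in> borel_measurable M"
  by (simp add: gaussian_innovation_def)

lemma gaussian_innovation_nonneg: "gaussian_innovation G v D \<Longrightarrow> 0 \<le> v"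
  by (simp add: gaussian_innovation_def)

lemma nn_integral_gaussian_innovation:
  assumes "gaussian_innovation G v D" "0 < \<epsilon>" "f \<in> borel_measurable G" "b \<in> borel_measurable G"
    and "(\<integral>\<^sup>+\<omega>. f \<omega> \<partial>M) < \<infinity>"
  shows "(\<integral>\<^sup>+\<omega>. f \<omega> * ennreal (heat_kernel \<epsilon> (b \<omega> + D \<omega>)) \<partial>M) =
    (\<integral>\<^sup>+\<omega>. f \<omega> * ennreal (heat_kernel (\<epsilon> + v) (b \<omega>)) \<partial>M)"
  using assms by (auto simp: gaussian_innovation_def)

lemma gaussian_innovation_0: "gaussian_innovation G 0 (\<lambda>_. 0)"
  by (rule gaussian_innovationI) auto

lemma gaussian_innovation_indep_normal:
  assumes G: "subalgebra M G"
    and ind: "indep_set (sets G) (sets (vimage_algebra (space M) D borel))"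
    and D: "distributed M lborel D (normal_density 0 \<sigma>)" "0 < \<sigma>"
  shows "gaussian_innovation G (\<sigma>\<^sup>2) D"
proof (rule gaussian_innovationI)
  show D_meas [measurable]: "D \<in> borel_measurable M"
    using distributed_measurable[OF D(1)] by simp
  fix \<epsilon> :: real and f :: "'a \<Rightarrow> ennreal" and b :: "'a \<Rightarrow> real"
  assume "0 < \<epsilon>" and f: "f \<in> borel_measurable G" and b: "b \<in> borel_measurable G"
  let ?B = "borel \<Otimes>\<^sub>M borel :: (ennreal \<times> real) measure"
  let ?U = "\<lambda>\<omega>. (f \<omega>, b \<omega>)"
  have [measurable]: "f \<in> borel_measurable M" "b \<in> borel_measurable M"
    using f b G by (auto intro: measurable_from_subalg)
  have pair: "distr M ?B ?U \<Otimes>\<^sub>M distr M borel D = distr M (?B \<Otimes>\<^sub>M borel) (\<lambda>\<omega>. (?U \<omega>, D \<omega>))"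
    using f b by (intro distr_pair_eq_of_indep_set[OF G _ D_meas ind]) auto
  have law_D: "distr M borel D = density lborel (normal_density 0 \<sigma>)"
    using distributed_distr_eq_density[OF D(1)] by (simp cong: distr_cong)
  interpret law: prob_space "distr M borel D" by (rule prob_space_distr) measurable
  have "(\<integral>\<^sup>+\<omega>. f \<omega> * ennreal (heat_kernel \<epsilon> (b \<omega> + D \<omega>)) \<partial>M) =
      (\<integral>\<^sup>+z. fst (fst z) * ennreal (heat_kernel \<epsilon> (snd (fst z) + snd z))
        \<partial>distr M (?B \<Otimes>\<^sub>M borel) (\<lambda>\<omega>. (?U \<omega>, D \<omega>)))"
    by (subst nn_integral_distr) simp_all
  also have "\<dots> = (\<integral>\<^sup>+p. \<integral>\<^sup>+y. fst p * ennreal (heat_kernel \<epsilon> (snd p + y)) \<partial>distr M borel D \<partial>distr M ?B ?U)"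
    unfolding pair[symmetric] by (subst law.nn_integral_fst[symmetric]) auto
  also have "\<dots> = (\<integral>\<^sup>+p. fst p * (\<integral>\<^sup>+y. ennreal (heat_kernel \<epsilon> (snd p + y)) \<partial>distr M borel D) \<partial>distr M ?B ?U)"
    by (intro nn_integral_cong nn_integral_cmult) measurable
  also have "\<dots> = (\<integral>\<^sup>+p. fst p * ennreal (heat_kernel (\<epsilon> + \<sigma>\<^sup>2) (snd p)) \<partial>distr M ?B ?U)"
    using \<open>0 < \<epsilon>\<close> D(2) by (simp add: law_D nn_integral_heat_kernel_normal)
  also have "\<dots> = (\<integral>\<^sup>+\<omega>. f \<omega> * ennreal (heat_kernel (\<epsilon> + \<sigma>\<^sup>2) (b \<omega>)) \<partial>M)"
    by (subst nn_integral_distr) auto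
  finally show "(\<integral>\<^sup>+\<omega>. f \<omega> * ennreal (heat_kernel \<epsilon> (b \<omega> + D \<omega>)) \<partial>M) =
      (\<integral>\<^sup>+\<omega>. f \<omega> * ennreal (heat_kernel (\<epsilon> + \<sigma>\<^sup>2) (b \<omega>)) \<partial>M)" .
qed simp

lemma gaussian_innovation_scale:
  assumes G: "subalgebra M G" and D: "gaussian_innovation G v D"
  shows "gaussian_innovation G (\<kappa>\<^sup>2 * v) (\<lambda>\<omega>. \<kappa> * D \<omega>)"
proof (cases "\<kappa> = 0")
  case False
  have [measurable]: "D \<in> borel_measurable M" by (rule gaussian_innovation_measurable[OF D])
  show ?thesis
  proof (rule gaussian_innovationI)
    fix \<epsilon> :: real and f :: "'a \<Rightarrow> ennreal" and b :: "'a \<Rightarrow> real"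
    assume "0 < \<epsilon>" and fb_G: "f \<in> borel_measurable G" "b \<in> borel_measurable G" and fin: "(\<integral>\<^sup>+\<omega>. f \<omega> \<partial>M) < \<infinity>"
    then have [measurable]: "f \<in> borel_measurable M" "b \<in> borel_measurable M"
      using G by (auto intro: measurable_from_subalg)
    have rescale: "ennreal (heat_kernel \<epsilon>' (x + \<kappa> * y)) =
        ennreal (heat_kernel (\<epsilon>' / \<kappa>\<^sup>2) (x / \<kappa> + y)) * ennreal (1 / \<bar>\<kappa>\<bar>)" for \<epsilon>' x y
    proof -
      have "heat_kernel \<epsilon>' (x + \<kappa> * y) = heat_kernel \<epsilon>' (\<kappa> * (x / \<kappa> + y))"
        using False by (simp add: distrib_left)
      also have "\<dots> = heat_kernel (\<epsilon>' / \<kappa>\<^sup>2) (x / \<kappa> + y) * (1 / \<bar>\<kappa>\<bar>)"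
        using False by (simp add: heat_kernel_scale)
      finally show ?thesis by (simp add: ennreal_mult''[symmetric])
    qed
    have "(\<integral>\<^sup>+\<omega>. f \<omega> * ennreal (heat_kernel \<epsilon> (b \<omega> + \<kappa> * D \<omega>)) \<partial>M) =
        (\<integral>\<^sup>+\<omega>. f \<omega> * ennreal (heat_kernel (\<epsilon> / \<kappa>\<^sup>2) (b \<omega> / \<kappa> + D \<omega>)) \<partial>M) * ennreal (1 / \<bar>\<kappa>\<bar>)"
      using \<open>0 < \<epsilon>\<close> by (subst nn_integral_multc[symmetric]) (auto simp: rescale mult.assoc)
    also have "(\<integral>\<^sup>+\<omega>. f \<omega> * ennreal (heat_kernel (\<epsilon> / \<kappa>\<^sup>2) (b \<omega> / \<kappa> + D \<omega>)) \<partial>M) =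
        (\<integral>\<^sup>+\<omega>. f \<omega> * ennreal (heat_kernel (\<epsilon> / \<kappa>\<^sup>2 + v) (b \<omega> / \<kappa>)) \<partial>M)"
      using \<open>0 < \<epsilon>\<close> False fb_G fin by (intro nn_integral_gaussian_innovation[OF D]) auto
    also have "\<dots> * ennreal (1 / \<bar>\<kappa>\<bar>) = (\<integral>\<^sup>+\<omega>. f \<omega> * ennreal (heat_kernel (\<epsilon> + \<kappa>\<^sup>2 * v) (b \<omega>)) \<partial>M)"
      using \<open>0 < \<epsilon>\<close> False gaussian_innovation_nonneg[OF D] rescale[of "\<epsilon> + \<kappa>\<^sup>2 * v" _ 0]
      by (subst nn_integral_multc[symmetric]) (auto simp: mult.assoc add_divide_distrib add_pos_nonneg)
    finally show "(\<integral>\<^sup>+\<omega>. f \<omega> * ennreal (heat_kernel \<epsilon> (b \<omega> + \<kappa> * D \<omega>)) \<partial>M) =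
        (\<integral>\<^sup>+\<omega>. f \<omega> * ennreal (heat_kernel (\<epsilon> + \<kappa>\<^sup>2 * v) (b \<omega>)) \<partial>M)" .
  qed (use gaussian_innovation_nonneg[OF D] in auto)
qed (simp add: gaussian_innovation_0)

lemma gaussian_innovation_add:
  assumes D: "gaussian_innovation G v D" "D \<in> borel_measurable G'"
    and D': "gaussian_innovation G' v' D'" and G: "subalgebra G' G"
  shows "gaussian_innovation G (v + v') (\<lambda>\<omega>. D \<omega> + D' \<omega>)"
proof (rule gaussian_innovationI)
  show "(\<lambda>\<omega>. D \<omega> + D' \<omega>) \<in> borel_measurable M"
    using D(1) D' by (intro borel_measurable_add gaussian_innovation_measurable)
  show "0 \<le> v + v'"
    using gaussian_innovation_nonneg[OF D(1)] gaussian_innovation_nonneg[OF D'] by simp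
  fix \<epsilon> :: real and f :: "'a \<Rightarrow> ennreal" and b :: "'a \<Rightarrow> real"
  assume "0 < \<epsilon>" and f: "f \<in> borel_measurable G" and b: "b \<in> borel_measurable G" and fin: "(\<integral>\<^sup>+\<omega>. f \<omega> \<partial>M) < \<infinity>"
  have "(\<integral>\<^sup>+\<omega>. f \<omega> * ennreal (heat_kernel \<epsilon> (b \<omega> + (D \<omega> + D' \<omega>))) \<partial>M) =
      (\<integral>\<^sup>+\<omega>. f \<omega> * ennreal (heat_kernel \<epsilon> ((b \<omega> + D \<omega>) + D' \<omega>)) \<partial>M)"
    by (simp add: add.assoc)
  also have "\<dots> = (\<integral>\<^sup>+\<omega>. f \<omega> * ennreal (heat_kernel (\<epsilon> + v') (b \<omega> + D \<omega>)) \<partial>M)"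
    using D(2) measurable_from_subalg[OF G f] measurable_from_subalg[OF G b]
    by (intro nn_integral_gaussian_innovation[OF D' \<open>0 < \<epsilon>\<close> _ _ fin]) auto
  also have "\<dots> = (\<integral>\<^sup>+\<omega>. f \<omega> * ennreal (heat_kernel (\<epsilon> + v' + v) (b \<omega>)) \<partial>M)"
    using \<open>0 < \<epsilon>\<close> gaussian_innovation_nonneg[OF D']
    by (intro nn_integral_gaussian_innovation[OF D(1) _ f b fin]) simp
  finally show "(\<integral>\<^sup>+\<omega>. f \<omega> * ennreal (heat_kernel \<epsilon> (b \<omega> + (D \<omega> + D' \<omega>))) \<partial>M) =
      (\<integral>\<^sup>+\<omega>. f \<omega> * ennreal (heat_kernel (\<epsilon> + (v + v')) (b \<omega>)) \<partial>M)"
    by (simp add: ac_simps)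
qed

lemma gaussian_innovation_sum:
  fixes G :: "nat \<Rightarrow> 'a measure"
  assumes G: "\<And>i j. i \<le> j \<Longrightarrow> subalgebra (G j) (G i)"
    and D: "\<And>i. gaussian_innovation (G i) (v i) (D i)" "\<And>i. D i \<in> borel_measurable (G (Suc i))"
  shows "gaussian_innovation (G 0) (\<Sum>i<n. v i) (\<lambda>\<omega>. \<Sum>i<n. D i \<omega>)"
proof (induction n)
  case (Suc n)
  have "(\<lambda>\<omega>. \<Sum>i<n. D i \<omega>) \<in> borel_measurable (G n)"
    using measurable_from_subalg[OF G D(2)] by (intro borel_measurable_sum) auto
  then show ?case
    using gaussian_innovation_add[OF Suc.IH _ D(1) G] by simp
qed (simp add: gaussian_innovation_0)

lemma gaussian_innovation_LIMSEQ:
  assumes G: "subalgebra M G" and D: "\<And>n. gaussian_innovation G (v n) (D n)"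
    and Y: "Y \<in> borel_measurable M"
    and lim: "AE \<omega> in M. (\<lambda>n. D n \<omega>) \<longlonglongrightarrow> Y \<omega>" "v \<longlonglongrightarrow> w"
  shows "gaussian_innovation G w Y"
proof (rule gaussian_innovationI[OF Y])
  have v: "0 \<le> v n" for n by (rule gaussian_innovation_nonneg[OF D])
  then show "0 \<le> w" using lim(2) by (intro LIMSEQ_le_const) auto
  fix \<epsilon> :: real and f :: "'a \<Rightarrow> ennreal" and b :: "'a \<Rightarrow> real"
  assume \<epsilon>: "0 < \<epsilon>" and fb: "f \<in> borel_measurable G" "b \<in> borel_measurable G"
    and fin: "(\<integral>\<^sup>+\<omega>. f \<omega> \<partial>M) < \<infinity>"
  have meas: "f \<in> borel_measurable M" "b \<in> borel_measurable M" "\<And>n. D n \<in> borel_measurable M"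
    using fb G by (auto intro: measurable_from_subalg gaussian_innovation_measurable[OF D])
  have "AE \<omega> in M. (\<lambda>n. b \<omega> + D n \<omega>) \<longlonglongrightarrow> b \<omega> + Y \<omega>"
    using lim(1) by eventually_elim (intro tendsto_add tendsto_const)
  then have "(\<lambda>n. \<integral>\<^sup>+\<omega>. f \<omega> * ennreal (heat_kernel (\<epsilon> + 0) (b \<omega> + D n \<omega>)) \<partial>M) \<longlonglongrightarrow>
      (\<integral>\<^sup>+\<omega>. f \<omega> * ennreal (heat_kernel (\<epsilon> + 0) (b \<omega> + Y \<omega>)) \<partial>M)"
    by (intro LIMSEQ_nn_integral_heat_kernel \<epsilon> fin meas borel_measurable_add Y tendsto_const order_refl)
  moreover have "(\<lambda>n. \<integral>\<^sup>+\<omega>. f \<omega> * ennreal (heat_kernel (\<epsilon> + v n) (b \<omega>)) \<partial>M) \<longlonglongrightarrow>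
      (\<integral>\<^sup>+\<omega>. f \<omega> * ennreal (heat_kernel (\<epsilon> + w) (b \<omega>)) \<partial>M)"
    by (intro LIMSEQ_nn_integral_heat_kernel \<epsilon> fin meas v lim(2)) simp
  ultimately show "(\<integral>\<^sup>+\<omega>. f \<omega> * ennreal (heat_kernel \<epsilon> (b \<omega> + Y \<omega>)) \<partial>M) =
      (\<integral>\<^sup>+\<omega>. f \<omega> * ennreal (heat_kernel (\<epsilon> + w) (b \<omega>)) \<partial>M)"
    using nn_integral_gaussian_innovation[OF D \<epsilon> fb fin] LIMSEQ_unique by simp
qed

lemma nn_integral_heat_kernel_gaussian:
  assumes "gaussian_innovation G v U" "0 < \<epsilon>"
  shows "(\<integral>\<^sup>+\<omega>. ennreal (heat_kernel \<epsilon> (U \<omega>)) \<partial>M) = ennreal (heat_kernel (\<epsilon> + v) 0)"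
  using nn_integral_gaussian_innovation[OF assms, of "\<lambda>_. 1" "\<lambda>_. 0"] by (simp add: emeasure_space_1)

lemma nn_integral_heat_kernel_mult_regression:
  assumes G: "subalgebra M G" and U: "gaussian_innovation H v U" "U \<in> borel_measurable G"
    and Y: "gaussian_innovation G w Y" and "0 < \<epsilon>"
  shows "(\<integral>\<^sup>+\<omega>. ennreal (heat_kernel \<epsilon> (U \<omega>) * heat_kernel \<epsilon> (\<kappa> * U \<omega> + Y \<omega>)) \<partial>M) =
    ennreal (1 / (2 * pi * sqrt ((\<epsilon> + v) * (\<epsilon> + (\<kappa>\<^sup>2 * v + w)) - (\<kappa> * v)\<^sup>2)))"
proof -
  define a where "a = \<epsilon> + w + \<kappa>\<^sup>2 * \<epsilon>"
  define h where "h = \<epsilon> * (\<epsilon> + w) / a"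
  have w: "0 \<le> w" and v: "0 \<le> v"
    using Y U(1) by (auto intro: gaussian_innovation_nonneg)
  have "0 < a" using \<open>0 < \<epsilon>\<close> w by (auto simp: a_def intro!: add_pos_nonneg)
  then have "0 < h" using \<open>0 < \<epsilon>\<close> w by (auto simp: h_def)
  have [measurable]: "U \<in> borel_measurable M" by (rule gaussian_innovation_measurable[OF U(1)])
  have "(\<integral>\<^sup>+\<omega>. ennreal (heat_kernel \<epsilon> (U \<omega>) * heat_kernel \<epsilon> (\<kappa> * U \<omega> + Y \<omega>)) \<partial>M) =
      (\<integral>\<^sup>+\<omega>. ennreal (heat_kernel \<epsilon> (U \<omega>)) * ennreal (heat_kernel \<epsilon> (\<kappa> * U \<omega> + Y \<omega>)) \<partial>M)"
    using \<open>0 < \<epsilon>\<close> by (simp add: ennreal_mult heat_kernel_nonneg)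
  also have "\<dots> = (\<integral>\<^sup>+\<omega>. ennreal (heat_kernel \<epsilon> (U \<omega>)) * ennreal (heat_kernel (\<epsilon> + w) (\<kappa> * U \<omega>)) \<partial>M)"
    using U(2) nn_integral_heat_kernel_gaussian[OF U(1) \<open>0 < \<epsilon>\<close>]
    by (intro nn_integral_gaussian_innovation[OF Y \<open>0 < \<epsilon>\<close>]) auto
  also have "\<dots> = (\<integral>\<^sup>+\<omega>. ennreal (heat_kernel a 0) * ennreal (heat_kernel h (U \<omega>)) \<partial>M)"
    using \<open>0 < \<epsilon>\<close> w \<open>0 < a\<close> \<open>0 < h\<close> heat_kernel_mult[of \<epsilon> "\<epsilon> + w" _ \<kappa>]
    by (simp add: ennreal_mult[symmetric] heat_kernel_nonneg a_def h_def)
  also have "\<dots> = ennreal (heat_kernel a 0 * heat_kernel (h + v) 0)"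
    using \<open>0 < a\<close> \<open>0 < h\<close> v
    by (simp add: nn_integral_cmult nn_integral_heat_kernel_gaussian[OF U(1)] ennreal_mult heat_kernel_nonneg)
  also have "heat_kernel a 0 * heat_kernel (h + v) 0 = 1 / (2 * pi * sqrt (a * (h + v)))"
    by (rule heat_kernel_0_mult)
  also have "a * (h + v) = (\<epsilon> + v) * (\<epsilon> + (\<kappa>\<^sup>2 * v + w)) - (\<kappa> * v)\<^sup>2"
  proof -
    have "a * h = \<epsilon> * (\<epsilon> + w)" using \<open>0 < a\<close> by (simp add: h_def)
    then show ?thesis by (simp add: distrib_left a_def) (simp add: algebra_simps power2_eq_square)
  qed
  finally show ?thesis .
qed

end

section \<open>The linear equation with continuous drift\<close>

locale continuous_drift =
  fixes \<alpha> :: "real \<Rightarrow> real"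
  assumes cont_drift: "continuous_on {0..} \<alpha>"
begin

definition integrating_factor :: "real \<Rightarrow> real" (\<open>\<mu>\<close>) where
  "\<mu> t = exp (integral {0..t} \<alpha>)"

definition clock :: "real \<Rightarrow> real" where
  "clock t = integral {0..t} (\<lambda>u. (\<mu> u)\<^sup>2)"

definition var :: "real \<Rightarrow> real" where
  "var t = clock t / (\<mu> t)\<^sup>2"

lemma integrating_factor_pos [simp]: "0 < \<mu> t"
  by (simp add: integrating_factor_def)

lemma integrating_factor_nonzero [simp]: "\<mu> t \<noteq> 0"
  by (simp add: integrating_factor_def)

lemma integrating_factor_0 [simp]: "\<mu> 0 = 1"
  by (simp add: integrating_factor_def)

lemma integrating_factor_deriv: "0 \<le> t \<Longrightarrow> (\<mu> has_real_derivative \<mu> t * \<alpha> t) (at t within {0..})"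
  unfolding integrating_factor_def[abs_def]
  by (auto intro!: derivative_eq_intros integral_has_real_derivative_atLeast cont_drift)

lemma continuous_on_integrating_factor: "continuous_on S \<mu>"
  unfolding integrating_factor_def[abs_def]
  by (intro continuous_intros continuous_on_subset[OF continuous_on_UNIV_integral_atLeast[OF cont_drift]]) simp

lemma isCont_integrating_factor: "isCont \<mu> t"
  using continuous_on_integrating_factor[of UNIV] by (simp add: continuous_on_eq_continuous_at)

lemma integrating_factor_measurable [measurable]: "\<mu> \<in> borel_measurable borel"
  by (rule borel_measurable_continuous_onI[OF continuous_on_integrating_factor])

lemma clock_deriv: "0 < t \<Longrightarrow> (clock has_real_derivative (\<mu> t)\<^sup>2) (at t)"
  using integral_has_real_derivative_atLeast[of 0 "\<lambda>u. (\<mu> u)\<^sup>2" t]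
  by (simp add: clock_def[abs_def] at_within_interior_atLeast continuous_on_power continuous_on_integrating_factor)

lemma continuous_on_clock: "continuous_on S clock"
  unfolding clock_def[abs_def]
  by (intro continuous_on_subset[OF continuous_on_UNIV_integral_atLeast]
      continuous_on_power continuous_on_integrating_factor) simp

lemma clock_measurable [measurable]: "clock \<in> borel_measurable borel"
  by (rule borel_measurable_continuous_onI[OF continuous_on_clock])

lemma isCont_clock: "isCont clock t"
  using continuous_on_clock[of UNIV] by (simp add: continuous_on_eq_continuous_at)

lemma clock_0 [simp]: "clock 0 = 0"
  by (simp add: clock_def)

lemma clock_less:
  assumes "0 \<le> s" "s < t"
  shows "clock s < clock t"
proof (rule DERIV_pos_imp_increasing_open[OF \<open>s < t\<close>])
  show "\<exists>y. (clock has_real_derivative y) (at x) \<and> 0 < y" if "s < x" "x < t" for x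
    using clock_deriv[of x] that \<open>0 \<le> s\<close> by (intro exI[of _ "(\<mu> x)\<^sup>2"]) auto
qed (rule continuous_on_clock)

lemma clock_pos: "0 < t \<Longrightarrow> 0 < clock t"
  using clock_less[of 0 t] by simp

lemma var_pos: "0 < t \<Longrightarrow> 0 < var t"
  by (simp add: var_def clock_pos)

lemma var_nonneg: "0 \<le> t \<Longrightarrow> 0 \<le> var t"
  using var_pos[of t] by (cases "t = 0") (auto simp: var_def)

lemma var_measurable [measurable]: "var \<in> borel_measurable borel"
  unfolding var_def[abs_def] by measurable

lemma LIMSEQ_clock_increment_sums:
  assumes "0 \<le> s" "s < r"
  defines "u \<equiv> uniform_grid s r"
  shows "(\<lambda>n. \<Sum>i<Suc n. (\<mu> (u n i))\<^sup>2 * (u n (Suc i) - u n i)) \<longlonglongrightarrow> clock r - clock s"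
proof -
  have "(\<lambda>n. \<Sum>i<Suc n. (\<mu> (u n i))\<^sup>2 * (u n (Suc i) - u n i)) \<longlonglongrightarrow> integral {s..r} (\<lambda>x. (\<mu> x)\<^sup>2 * 1)"
    unfolding u_def using uniform_grid_less_Suc[OF \<open>s < r\<close>]
    by (intro LIMSEQ_Riemann_Stieltjes_sums \<open>s < r\<close> continuous_intros continuous_on_integrating_factor)
      (auto intro: less_imp_le)
  moreover have "clock s + integral {s..r} (\<lambda>x. (\<mu> x)\<^sup>2) = clock r"
    unfolding clock_def using assms
    by (intro Henstock_Kurzweil_Integration.integral_combine integrable_continuous_interval
        continuous_intros continuous_on_integrating_factor) auto
  then have "integral {s..r} (\<lambda>x. (\<mu> x)\<^sup>2) = clock r - clock s" by simp
  ultimately show ?thesis by (simp only: mult_1_right)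
qed

lemma LIMSEQ_solution_noise_sums:
  fixes x w :: "real \<Rightarrow> real"
  assumes "0 \<le> s" "s < r" and x: "continuous_on {0..} x"
    and eq: "\<And>t. 0 \<le> t \<Longrightarrow> x t = integral {0..t} (\<lambda>v. - \<alpha> v * x v) + w t"
  defines "u \<equiv> uniform_grid s r"
  shows "(\<lambda>n. \<Sum>i<Suc n. \<mu> (u n i) * (w (u n (Suc i)) - w (u n i))) \<longlonglongrightarrow> \<mu> r * x r - \<mu> s * x s"
proof -
  define y where "y t = integral {0..t} (\<lambda>v. - \<alpha> v * x v)" for t
  have sub: "{s..r} \<subseteq> {0..}" using \<open>0 \<le> s\<close> by auto
  have cont: "continuous_on {s..r} x" "continuous_on {s..r} \<alpha>" "continuous_on {s..r} \<mu>"
    using x cont_drift sub by (auto intro: continuous_on_subset continuous_on_integrating_factor)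
  have "(y has_real_derivative - \<alpha> v * x v) (at v within {s..r})" if "v \<in> {s..r}" for v
  proof (rule DERIV_subset[OF _ sub])
    show "(y has_real_derivative - \<alpha> v * x v) (at v within {0..})"
      unfolding y_def[abs_def] using that \<open>0 \<le> s\<close>
      by (intro integral_has_real_derivative_atLeast continuous_intros x cont_drift) auto
  qed
  moreover have "(\<mu> has_real_derivative \<mu> v * \<alpha> v) (at v within {s..r})" if "v \<in> {s..r}" for v
    using that \<open>0 \<le> s\<close> by (intro DERIV_subset[OF integrating_factor_deriv sub]) auto
  ultimately have "(\<lambda>n. \<Sum>i<Suc n. \<mu> (u n i) * ((x (u n (Suc i)) - y (u n (Suc i))) - (x (u n i) - y (u n i)))) \<longlonglongrightarrow>
      \<mu> r * x r - \<mu> s * x s - integral {s..r} (\<lambda>v. x v * (\<mu> v * \<alpha> v)) - integral {s..r} (\<lambda>v. \<mu> v * (- \<alpha> v * x v))"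
    unfolding u_def by (intro LIMSEQ_Riemann_Stieltjes_sums_by_parts \<open>s < r\<close> continuous_intros cont)
  moreover have "integral {s..r} (\<lambda>v. \<mu> v * (- \<alpha> v * x v)) = - integral {s..r} (\<lambda>v. x v * (\<mu> v * \<alpha> v))"
    by (simp add: ac_simps)
  moreover have "x (u n i) - y (u n i) = w (u n i)" for n i
    using eq[of "u n i"] uniform_grid_ge[OF \<open>s < r\<close>, of n i] \<open>0 \<le> s\<close> by (simp add: y_def u_def)
  ultimately show ?thesis by simp
qed

definition sq_corr :: "real \<Rightarrow> real \<Rightarrow> real" where
  "sq_corr s r = clock (min s r) / clock (max s r)"

lemma sq_corr_commute: "sq_corr s r = sq_corr r s"
  by (simp add: sq_corr_def min.commute max.commute)

lemma sq_corr_pos: "0 < s \<Longrightarrow> 0 < r \<Longrightarrow> 0 < sq_corr s r"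
  by (simp add: sq_corr_def clock_pos)

lemma sq_corr_less_1: "0 < s \<Longrightarrow> 0 < r \<Longrightarrow> s \<noteq> r \<Longrightarrow> sq_corr s r < 1"
  using clock_less[of s r] clock_less[of r s] clock_pos[of s] clock_pos[of r]
  by (cases s r rule: linorder_cases) (auto simp: sq_corr_def min_def max_def)

lemma sq_corr_mult_var_var: "0 < s \<Longrightarrow> s < r \<Longrightarrow> sq_corr s r * (var s * var r) = (\<mu> s / \<mu> r * var s)\<^sup>2"
  using clock_pos[of r] by (simp add: sq_corr_def var_def min_def max_def power2_eq_square)

text \<open>
  Up to a constant, the sum over the two orders of the arguments bounds the covariance of the heat
  kernels at times \<open>s\<close> and \<open>r\<close>. Since \<open>1 / var\<close> is the logarithmic derivative of the clock, the
  majorant is, up to sign, a derivative of \<open>2 * sqrt (1 - sq_corr s r)\<close> in \<open>r\<close>.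
\<close>

definition cov_majorant :: "real \<Rightarrow> real \<Rightarrow> real" where
  "cov_majorant s r = sq_corr s r / sqrt (1 - sq_corr s r) / var r"

lemma cov_majorant_nonneg: "0 < s \<Longrightarrow> 0 < r \<Longrightarrow> s \<noteq> r \<Longrightarrow> 0 \<le> cov_majorant s r"
  using sq_corr_pos[of s r] sq_corr_less_1[of s r] var_pos[of r] by (simp add: cov_majorant_def)

lemma cov_majorant_measurable [measurable]:
  "(\<lambda>(s, r). cov_majorant s r) \<in> borel_measurable (borel \<Otimes>\<^sub>M borel)"
  unfolding cov_majorant_def sq_corr_def by measurable

lemma nn_integral_cov_majorant_below:
  assumes s: "0 < s"
  shows "(\<integral>\<^sup>+r\<in>{0<..<s}. ennreal (cov_majorant s r) \<partial>lborel) = 2"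
proof -
  have "(\<integral>\<^sup>+r\<in>{0<..<s}. ennreal (cov_majorant s r) \<partial>lborel) =
      (\<integral>\<^sup>+r\<in>{0<..<s}. ennreal ((\<mu> r)\<^sup>2 / clock s / sqrt (1 - clock r / clock s)) \<partial>lborel)"
  proof (rule nn_integral_cong)
    have "cov_majorant s r = (\<mu> r)\<^sup>2 / clock s / sqrt (1 - clock r / clock s)" if "r \<in> {0<..<s}" for r
      using that clock_pos[of r] by (simp add: cov_majorant_def sq_corr_def var_def min_def max_def)
    then show "ennreal (cov_majorant s r) * indicator {0<..<s} r =
        ennreal ((\<mu> r)\<^sup>2 / clock s / sqrt (1 - clock r / clock s)) * indicator {0<..<s} r" for r
      by (simp split: split_indicator)
  qed
  also have "\<dots> = ennreal (1 * (2 * sqrt (1 - clock 0 / clock s) - 2 * sqrt (1 - clock s / clock s)))"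
    using clock_pos[OF s] clock_less[of _ s]
    by (intro nn_integral_deriv_div_sqrt_one_minus s continuous_intros continuous_on_clock
        isCont_integrating_factor) (auto intro!: derivative_eq_intros clock_deriv)
  also have "\<dots> = 2" using clock_pos[OF s] by simp
  finally show ?thesis .
qed

lemma nn_integral_cov_majorant_above:
  assumes s: "0 < s" "s < t"
  shows "(\<integral>\<^sup>+r\<in>{s<..<t}. ennreal (cov_majorant s r) \<partial>lborel) \<le> 2"
proof -
  have pos: "0 < clock r" if "s \<le> r" for r using clock_pos[of r] that s by simp
  have "(\<integral>\<^sup>+r\<in>{s<..<t}. ennreal (cov_majorant s r) \<partial>lborel) =
      (\<integral>\<^sup>+r\<in>{s<..<t}. ennreal ((\<mu> r)\<^sup>2 * clock s / (clock r)\<^sup>2 / sqrt (1 - clock s / clock r)) \<partial>lborel)"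
  proof (rule nn_integral_cong)
    have "cov_majorant s r = (\<mu> r)\<^sup>2 * clock s / (clock r)\<^sup>2 / sqrt (1 - clock s / clock r)"
      if "r \<in> {s<..<t}" for r
      using that by (simp add: cov_majorant_def sq_corr_def var_def min_def max_def power2_eq_square mult_ac)
    then show "ennreal (cov_majorant s r) * indicator {s<..<t} r =
        ennreal ((\<mu> r)\<^sup>2 * clock s / (clock r)\<^sup>2 / sqrt (1 - clock s / clock r)) * indicator {s<..<t} r" for r
      by (simp split: split_indicator)
  qed
  also have "\<dots> = ennreal (- 1 * (2 * sqrt (1 - clock s / clock s) - 2 * sqrt (1 - clock s / clock t)))"
  proof (rule nn_integral_deriv_div_sqrt_one_minus)
    show "continuous_on {s..t} (\<lambda>r. clock s / clock r)"
      using pos by (intro continuous_intros continuous_on_clock) (force dest: pos)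
    fix r assume r: "s < r" "r < t"
    have "clock r \<noteq> 0" using pos[of r] r by simp
    then show "((\<lambda>r. clock s / clock r) has_real_derivative - 1 * ((\<mu> r)\<^sup>2 * clock s / (clock r)\<^sup>2)) (at r)"
      using r s by (auto intro!: derivative_eq_intros clock_deriv simp: power2_eq_square)
    show "isCont (\<lambda>r. (\<mu> r)\<^sup>2 * clock s / (clock r)\<^sup>2) r"
      using \<open>clock r \<noteq> 0\<close> by (intro continuous_intros isCont_integrating_factor isCont_clock) simp
    show "clock s / clock r < 1" "0 \<le> (\<mu> r)\<^sup>2 * clock s / (clock r)\<^sup>2"
      using clock_less[of s r] pos[of s] pos[of r] r s by auto
  qed (use s in simp_all)
  also have "\<dots> \<le> ennreal 2"
    using pos[of s] pos[of t] s by (intro ennreal_leI) auto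
  finally show ?thesis by simp
qed

lemma nn_integral_cov_majorant_le:
  assumes s: "0 < s" "s < t"
  shows "(\<integral>\<^sup>+r\<in>{0..t}. ennreal (cov_majorant s r) \<partial>lborel) \<le> 4"
proof -
  let ?f = "\<lambda>r. ennreal (cov_majorant s r)"
  have "(\<integral>\<^sup>+r\<in>{0..t}. ?f r \<partial>lborel) =
      (\<integral>\<^sup>+r. ?f r * indicator {0<..<s} r + ?f r * indicator {s<..<t} r \<partial>lborel)"
  proof (rule nn_integral_cong_AE)
    have "AE r in lborel. r \<noteq> 0" "AE r in lborel. r \<noteq> s" "AE r in lborel. r \<noteq> t"
      by (rule AE_lborel_singleton)+
    then show "AE r in lborel. ?f r * indicator {0..t} r = ?f r * indicator {0<..<s} r + ?f r * indicator {s<..<t} r"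
      by eventually_elim (use s in \<open>auto split: split_indicator\<close>)
  qed
  also have "\<dots> = (\<integral>\<^sup>+r\<in>{0<..<s}. ?f r \<partial>lborel) + (\<integral>\<^sup>+r\<in>{s<..<t}. ?f r \<partial>lborel)"
    by (intro nn_integral_add) measurable
  also have "\<dots> \<le> 2 + 2"
    using s nn_integral_cov_majorant_above[OF s]
    by (intro add_mono) (simp_all add: nn_integral_cov_majorant_below)
  finally show ?thesis by simp
qed

lemma nn_integral_nn_integral_cov_majorant_le:
  assumes "0 \<le> t"
  shows "(\<integral>\<^sup>+s\<in>{0..t}. (\<integral>\<^sup>+r\<in>{0..t}. ennreal (cov_majorant s r) \<partial>lborel) \<partial>lborel) \<le> ennreal (4 * t)"
proof -
  have "(\<integral>\<^sup>+s\<in>{0..t}. (\<integral>\<^sup>+r\<in>{0..t}. ennreal (cov_majorant s r) \<partial>lborel) \<partial>lborel) \<le>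
      (\<integral>\<^sup>+s\<in>{0..t}. 4 \<partial>lborel)"
  proof (rule nn_integral_mono_AE)
    show "AE s in lborel. (\<integral>\<^sup>+r\<in>{0..t}. ennreal (cov_majorant s r) \<partial>lborel) * indicator {0..t} s \<le>
        4 * indicator {0..t} s"
      using AE_lborel_singleton[of 0] AE_lborel_singleton[of t]
      by eventually_elim (auto intro: nn_integral_cov_majorant_le split: split_indicator)
  qed
  also have "\<dots> = ennreal (4 * t)"
    using assms by (simp add: nn_integral_cmult ennreal_mult)
  finally show ?thesis .
qed

end

locale coercive_drift = continuous_drift +
  fixes c :: real
  assumes c_pos: "0 < c"
    and c_le_drift: "\<And>t. 0 \<le> t \<Longrightarrow> c \<le> \<alpha> t"
begin

lemma var_le:
  assumes "0 \<le> t"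
  shows "var t \<le> 1 / (2 * c)"
proof -
  have "((\<lambda>u. 2 * c * (\<mu> u)\<^sup>2) has_integral 2 * c * clock t) {0..t}"
    unfolding clock_def
    by (intro has_integral_mult_right integrable_integral integrable_continuous_interval
        continuous_intros continuous_on_integrating_factor)
  moreover have "((\<lambda>u. 2 * \<mu> u * (\<mu> u * \<alpha> u)) has_integral (\<mu> t)\<^sup>2 - (\<mu> 0)\<^sup>2) {0..t}"
  proof (rule fundamental_theorem_of_calculus[OF assms])
    fix u assume "u \<in> {0..t}"
    then have "(\<mu> has_real_derivative \<mu> u * \<alpha> u) (at u within {0..t})"
      by (intro DERIV_subset[OF integrating_factor_deriv]) auto
    then have "((\<lambda>u. (\<mu> u)\<^sup>2) has_real_derivative 2 * \<mu> u * (\<mu> u * \<alpha> u)) (at u within {0..t})"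
      by (auto intro!: derivative_eq_intros)
    then show "((\<lambda>u. (\<mu> u)\<^sup>2) has_vector_derivative 2 * \<mu> u * (\<mu> u * \<alpha> u)) (at u within {0..t})"
      by (simp add: has_real_derivative_iff_has_vector_derivative)
  qed
  moreover have "2 * c * (\<mu> u)\<^sup>2 \<le> 2 * \<mu> u * (\<mu> u * \<alpha> u)" if "u \<in> {0..t}" for u
  proof -
    have "c * (2 * (\<mu> u)\<^sup>2) \<le> \<alpha> u * (2 * (\<mu> u)\<^sup>2)"
      using c_le_drift that by (intro mult_right_mono) auto
    then show ?thesis by (simp add: power2_eq_square mult_ac)
  qed
  ultimately have "2 * c * clock t \<le> (\<mu> t)\<^sup>2 - (\<mu> 0)\<^sup>2"
    by (rule has_integral_le)
  then have "2 * c * clock t \<le> (\<mu> t)\<^sup>2" by simp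
  then show ?thesis using c_pos by (simp add: var_def field_simps)
qed

end

section \<open>Approximate local times\<close>

lemma (in complete_filtered_prob_space) adapted_continuous_version:
  assumes X: "adapted F X" "continuous_paths M X"
  obtains X' where "adapted F X'" "\<And>\<omega>. continuous_on {0..} (\<lambda>t. X' t \<omega>)" "AE \<omega> in M. \<forall>t. X' t \<omega> = X t \<omega>"
proof
  define G where "G = {\<omega> \<in> space M. continuous_on {0..} (\<lambda>t. X t \<omega>)}"
  define X' where "X' t \<omega> = (if \<omega> \<in> G then X t \<omega> else 0)" for t \<omega>
  have AE_G: "AE \<omega> in M. \<omega> \<in> G"
    using X(2) AE_space unfolding continuous_paths_def by (auto simp: G_def)
  have G_F: "G \<in> sets (F t)" if "0 \<le> t" for t
  proof -
    have "space M - G \<in> null_sets M"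
      using AE_G unfolding AE_iff_null_sets by (simp add: set_diff_eq)
    then have "space M - G \<in> sets (F t)"
      using null_sets_F F_mono[of 0 t] that by auto
    moreover have "G = space (F t) - (space M - G)"
      using subalgebra_F[OF that] by (auto simp: G_def subalgebra_def)
    ultimately show ?thesis by (metis sets.compl_sets)
  qed
  show "adapted F X'"
    unfolding adapted_def
  proof (intro allI impI)
    fix t :: real assume "0 \<le> t"
    then have "X t \<in> borel_measurable (F t)" using X(1) by (simp add: adapted_def)
    then show "X' t \<in> borel_measurable (F t)"
      unfolding X'_def[abs_def] using G_F[OF \<open>0 \<le> t\<close>] by measurable
  qed
  show "continuous_on {0..} (\<lambda>t. X' t \<omega>)" for \<omega>
    by (cases "\<omega> \<in> G") (simp_all add: X'_def, simp add: G_def)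
  show "AE \<omega> in M. \<forall>t. X' t \<omega> = X t \<omega>"
    using AE_G by eventually_elim (simp add: X'_def)
qed

lemma sde_solution_cong_AE:
  assumes X: "sde_solution M F W \<alpha> X" and "adapted F X'" and eq: "AE \<omega> in M. \<forall>t. X' t \<omega> = X t \<omega>"
  shows "sde_solution M F W \<alpha> X'"
proof -
  have "AE \<omega> in M. continuous_on {0..} (\<lambda>t. X t \<omega>)" "AE \<omega> in M. X 0 \<omega> = 0"
    "AE \<omega> in M. \<forall>t\<ge>0. X t \<omega> = (LINT s:{0..t}|lborel. - \<alpha> s * X s \<omega>) + W t \<omega>"
    using X by (auto simp: sde_solution_def continuous_paths_def)
  then have "AE \<omega> in M. continuous_on {0..} (\<lambda>t. X' t \<omega>)" "AE \<omega> in M. X' 0 \<omega> = 0"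
    "AE \<omega> in M. \<forall>t\<ge>0. X' t \<omega> = (LINT s:{0..t}|lborel. - \<alpha> s * X' s \<omega>) + W t \<omega>"
    using eq by (eventually_elim, simp)+
  with \<open>adapted F X'\<close> show ?thesis
    by (simp add: sde_solution_def continuous_paths_def)
qed

lemma local_time_cong_AE:
  assumes L: "local_time M X x L" and eq: "AE \<omega> in M. \<forall>t. X' t \<omega> = X t \<omega>"
  shows "local_time M X' x L"
proof -
  have "(\<integral>\<^sup>+\<omega>. ennreal ((approx_local_time X' x \<epsilon> t \<omega> - L t \<omega>)\<^sup>2) \<partial>M) =
      (\<integral>\<^sup>+\<omega>. ennreal ((approx_local_time X x \<epsilon> t \<omega> - L t \<omega>)\<^sup>2) \<partial>M)" for \<epsilon> t
    by (rule nn_integral_cong_AE) (use eq in eventually_elim, simp add: approx_local_time_def)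
  then show ?thesis using L by (simp add: local_time_def)
qed

locale continuous_process = prob_space M for M :: "'a measure" +
  fixes X :: "real \<Rightarrow> 'a \<Rightarrow> real"
  assumes X_measurable: "\<And>t. 0 \<le> t \<Longrightarrow> X t \<in> borel_measurable M"
    and X_cont: "\<And>\<omega>. continuous_on {0..} (\<lambda>t. X t \<omega>)"
begin

lemma X_joint [measurable]: "(\<lambda>(t, \<omega>). X (max 0 t) \<omega>) \<in> borel_measurable (borel \<Otimes>\<^sub>M M)"
proof (rule measurable_continuous_paths)
  show "continuous_on UNIV (\<lambda>t. X (max 0 t) \<omega>)" for \<omega>
    by (rule continuous_on_compose2[OF X_cont]) (auto intro: continuous_intros)
qed (simp add: X_measurable)

lemma approx_local_time_nonneg: "0 \<le> \<epsilon> \<Longrightarrow> 0 \<le> approx_local_time X x \<epsilon> t \<omega>"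
  unfolding approx_local_time_def set_lebesgue_integral_def
  by (intro Bochner_Integration.integral_nonneg) (auto simp: heat_kernel_nonneg split: split_indicator)

lemma ennreal_approx_local_time:
  assumes "0 < \<epsilon>"
  shows "ennreal (approx_local_time X x \<epsilon> t \<omega>) =
    (\<integral>\<^sup>+r\<in>{0..t}. ennreal (heat_kernel \<epsilon> (X (max 0 r) \<omega> - x)) \<partial>lborel)"
proof -
  have "continuous_on {0..t} (\<lambda>r. heat_kernel \<epsilon> (X r \<omega> - x))"
    by (intro continuous_on_heat_kernel assms continuous_intros continuous_on_subset[OF X_cont]) auto
  then have "integrable lborel (\<lambda>r. indicator {0..t} r *\<^sub>R heat_kernel \<epsilon> (X r \<omega> - x))"
    using borel_integrable_atLeastAtMost' unfolding set_integrable_def by blast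
  then have "ennreal (approx_local_time X x \<epsilon> t \<omega>) =
      (\<integral>\<^sup>+r. ennreal (indicator {0..t} r *\<^sub>R heat_kernel \<epsilon> (X r \<omega> - x)) \<partial>lborel)"
    unfolding approx_local_time_def set_lebesgue_integral_def using assms
    by (subst nn_integral_eq_integral) (auto simp: heat_kernel_nonneg split: split_indicator)
  also have "\<dots> = (\<integral>\<^sup>+r\<in>{0..t}. ennreal (heat_kernel \<epsilon> (X (max 0 r) \<omega> - x)) \<partial>lborel)"
    by (intro nn_integral_cong) (auto simp: max_def split: split_indicator)
  finally show ?thesis .
qed

lemma approx_local_time_measurable [measurable]:
  assumes "0 < \<epsilon>"
  shows "approx_local_time X x \<epsilon> t \<in> borel_measurable M"
proof -
  have "approx_local_time X x \<epsilon> t =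
      (\<lambda>\<omega>. enn2real (\<integral>\<^sup>+r\<in>{0..t}. ennreal (heat_kernel \<epsilon> (X (max 0 r) \<omega> - x)) \<partial>lborel))"
    using assms by (simp add: ennreal_approx_local_time[symmetric] approx_local_time_nonneg)
  also have "\<dots> \<in> borel_measurable M" by measurable
  finally show ?thesis .
qed

lemma nn_integral_approx_local_time:
  assumes "0 < \<epsilon>"
  shows "(\<integral>\<^sup>+\<omega>. ennreal (approx_local_time X x \<epsilon> t \<omega>) \<partial>M) =
    (\<integral>\<^sup>+r\<in>{0..t}. (\<integral>\<^sup>+\<omega>. ennreal (heat_kernel \<epsilon> (X r \<omega> - x)) \<partial>M) \<partial>lborel)"
proof -
  interpret P: pair_sigma_finite lborel M ..
  have "(\<integral>\<^sup>+\<omega>. ennreal (approx_local_time X x \<epsilon> t \<omega>) \<partial>M) =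
      (\<integral>\<^sup>+r. \<integral>\<^sup>+\<omega>. ennreal (heat_kernel \<epsilon> (X (max 0 r) \<omega> - x)) * indicator {0..t} r \<partial>M \<partial>lborel)"
    unfolding ennreal_approx_local_time[OF assms] by (rule P.Fubini') measurable
  also have "\<dots> = (\<integral>\<^sup>+r\<in>{0..t}. (\<integral>\<^sup>+\<omega>. ennreal (heat_kernel \<epsilon> (X r \<omega> - x)) \<partial>M) \<partial>lborel)"
    by (intro nn_integral_cong) (simp split: split_indicator)
  finally show ?thesis .
qed

lemma nn_integral_approx_local_time_power2:
  assumes "0 < \<epsilon>"
  shows "(\<integral>\<^sup>+\<omega>. (ennreal (approx_local_time X x \<epsilon> t \<omega>))\<^sup>2 \<partial>M) =
    (\<integral>\<^sup>+s\<in>{0..t}. (\<integral>\<^sup>+r\<in>{0..t}.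
      (\<integral>\<^sup>+\<omega>. ennreal (heat_kernel \<epsilon> (X s \<omega> - x) * heat_kernel \<epsilon> (X r \<omega> - x)) \<partial>M) \<partial>lborel) \<partial>lborel)"
proof -
  interpret P: pair_sigma_finite lborel M ..
  define g where "g r \<omega> = ennreal (heat_kernel \<epsilon> (X (max 0 r) \<omega> - x)) * indicator {0..t} r" for r \<omega>
  have "case_prod g \<in> borel_measurable (borel \<Otimes>\<^sub>M M)" unfolding g_def by measurable
  then have "(\<integral>\<^sup>+\<omega>. (ennreal (approx_local_time X x \<epsilon> t \<omega>))\<^sup>2 \<partial>M) =
      (\<integral>\<^sup>+s. \<integral>\<^sup>+r. \<integral>\<^sup>+\<omega>. g s \<omega> * g r \<omega> \<partial>M \<partial>lborel \<partial>lborel)"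
    unfolding ennreal_approx_local_time[OF assms] g_def
    by (intro P.nn_integral_power2_nn_integral) simp
  also have "\<dots> = (\<integral>\<^sup>+s\<in>{0..t}. (\<integral>\<^sup>+r\<in>{0..t}.
      (\<integral>\<^sup>+\<omega>. ennreal (heat_kernel \<epsilon> (X s \<omega> - x) * heat_kernel \<epsilon> (X r \<omega> - x)) \<partial>M) \<partial>lborel) \<partial>lborel)"
    using assms
    by (intro nn_integral_cong)
      (auto simp: g_def ennreal_mult heat_kernel_nonneg split: split_indicator intro!: nn_integral_cong)
  finally show ?thesis .
qed

end

section \<open>The Ornstein-Uhlenbeck process\<close>

locale brownian = complete_filtered_prob_space M F for M :: "'a measure" and F +
  fixes W :: "real \<Rightarrow> 'a \<Rightarrow> real"
  assumes bm: "brownian_motion M F W"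
begin

lemma subalgebra_F_mono: "0 \<le> s \<Longrightarrow> s \<le> t \<Longrightarrow> subalgebra (F t) (F s)"
  using subalgebra_F[of s] subalgebra_F[of t] F_mono[of s t] by (simp add: subalgebra_def)

lemma W_adapted: "0 \<le> s \<Longrightarrow> s \<le> t \<Longrightarrow> W s \<in> borel_measurable (F t)"
  using bm by (auto simp: brownian_motion_def adapted_def intro: measurable_from_subalg[OF subalgebra_F_mono])

lemma gaussian_innovation_W:
  assumes "0 \<le> s" "s < t"
  shows "gaussian_innovation (F s) (t - s) (\<lambda>\<omega>. W t \<omega> - W s \<omega>)"
proof -
  have "gaussian_innovation (F s) ((sqrt (t - s))\<^sup>2) (\<lambda>\<omega>. W t \<omega> - W s \<omega>)"
    using bm assms unfolding brownian_motion_def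
    by (intro gaussian_innovation_indep_normal subalgebra_F) auto
  then show ?thesis using assms by simp
qed

lemma gaussian_innovation_weighted_increments:
  assumes u: "0 \<le> u 0" "\<And>i. u i < u (Suc i)"
  shows "gaussian_innovation (F (u 0)) (\<Sum>i<n. (\<kappa> i)\<^sup>2 * (u (Suc i) - u i))
    (\<lambda>\<omega>. \<Sum>i<n. \<kappa> i * (W (u (Suc i)) \<omega> - W (u i) \<omega>))"
proof (rule gaussian_innovation_sum[where G = "\<lambda>i. F (u i)"])
  have mono: "u i \<le> u j" if "i \<le> j" for i j
    using lift_Suc_mono_le[of u, OF less_imp_le[OF u(2)] that] .
  have nonneg: "0 \<le> u i" for i using mono[of 0 i] u(1) by simp
  show "subalgebra (F (u j)) (F (u i))" if "i \<le> j" for i j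
    by (rule subalgebra_F_mono[OF nonneg mono[OF that]])
  show "gaussian_innovation (F (u i)) ((\<kappa> i)\<^sup>2 * (u (Suc i) - u i))
      (\<lambda>\<omega>. \<kappa> i * (W (u (Suc i)) \<omega> - W (u i) \<omega>))" for i
    by (intro gaussian_innovation_scale subalgebra_F gaussian_innovation_W nonneg u)
  show "(\<lambda>\<omega>. \<kappa> i * (W (u (Suc i)) \<omega> - W (u i) \<omega>)) \<in> borel_measurable (F (u (Suc i)))" for i
    by (intro borel_measurable_times borel_measurable_diff borel_measurable_const W_adapted nonneg mono) auto
qed

end

locale ou_process = brownian M F W + continuous_drift \<alpha>
  for M :: "'a measure" and F W \<alpha> +
  fixes X :: "real \<Rightarrow> 'a \<Rightarrow> real"
  assumes solution: "sde_solution M F W \<alpha> X"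
    and continuous: "\<And>\<omega>. continuous_on {0..} (\<lambda>t. X t \<omega>)"
begin

lemma X_adapted: "0 \<le> t \<Longrightarrow> X t \<in> borel_measurable (F t)"
  using solution by (simp add: sde_solution_def adapted_def)

sublocale continuous_process M X
proof
  show "X t \<in> borel_measurable M" if "0 \<le> t" for t
    by (rule measurable_from_subalg[OF subalgebra_F[OF that] X_adapted[OF that]])
qed (rule continuous)

lemma AE_X_eq: "AE \<omega> in M. \<forall>t\<ge>0. X t \<omega> = integral {0..t} (\<lambda>u. - \<alpha> u * X u \<omega>) + W t \<omega>"
proof -
  have "AE \<omega> in M. \<forall>t\<ge>0. X t \<omega> = (LINT s:{0..t}|lborel. - \<alpha> s * X s \<omega>) + W t \<omega>"
    using solution by (simp add: sde_solution_def)
  then show ?thesis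
  proof eventually_elim
    case (elim \<omega>)
    have "(LINT s:{0..t}|lborel. - \<alpha> s * X s \<omega>) = integral {0..t} (\<lambda>u. - \<alpha> u * X u \<omega>)" for t
      by (intro set_borel_integral_eq_integral borel_integrable_atLeastAtMost' continuous_intros
          continuous_on_subset[OF cont_drift] continuous_on_subset[OF continuous]) auto
    with elim show ?case by simp
  qed
qed

lemma gaussian_innovation_residual:
  assumes s: "0 \<le> s" "s < r"
  shows "gaussian_innovation (F s) ((clock r - clock s) / (\<mu> r)\<^sup>2) (\<lambda>\<omega>. X r \<omega> - \<mu> s / \<mu> r * X s \<omega>)"
proof -
  let ?u = "uniform_grid s r"
  have "gaussian_innovation (F s) (clock r - clock s) (\<lambda>\<omega>. \<mu> r * X r \<omega> - \<mu> s * X s \<omega>)"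
  proof (rule gaussian_innovation_LIMSEQ[OF subalgebra_F[OF s(1)]])
    show "gaussian_innovation (F s) (\<Sum>i<Suc n. (\<mu> (?u n i))\<^sup>2 * (?u n (Suc i) - ?u n i))
        (\<lambda>\<omega>. \<Sum>i<Suc n. \<mu> (?u n i) * (W (?u n (Suc i)) \<omega> - W (?u n i) \<omega>))" for n
      using gaussian_innovation_weighted_increments[of "?u n" "\<lambda>i. \<mu> (?u n i)" "Suc n"] s
      by (simp add: uniform_grid_less_Suc)
    show "(\<lambda>\<omega>. \<mu> r * X r \<omega> - \<mu> s * X s \<omega>) \<in> borel_measurable M"
      using s by (intro borel_measurable_diff borel_measurable_times borel_measurable_const X_measurable) auto
    show "AE \<omega> in M. (\<lambda>n. \<Sum>i<Suc n. \<mu> (?u n i) * (W (?u n (Suc i)) \<omega> - W (?u n i) \<omega>))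
        \<longlonglongrightarrow> \<mu> r * X r \<omega> - \<mu> s * X s \<omega>"
      using AE_X_eq by eventually_elim (rule LIMSEQ_solution_noise_sums[OF s continuous], simp)
    show "(\<lambda>n. \<Sum>i<Suc n. (\<mu> (?u n i))\<^sup>2 * (?u n (Suc i) - ?u n i)) \<longlonglongrightarrow> clock r - clock s"
      by (rule LIMSEQ_clock_increment_sums[OF s])
  qed
  from gaussian_innovation_scale[OF subalgebra_F[OF s(1)] this, of "1 / \<mu> r"] show ?thesis
    by (simp add: right_diff_distrib diff_divide_distrib power_divide)
qed

lemma gaussian_innovation_X:
  assumes "0 < r"
  shows "gaussian_innovation (F 0) (var r) (X r)"
proof (rule gaussian_innovation_LIMSEQ)
  show "gaussian_innovation (F 0) (var r) (\<lambda>\<omega>. X r \<omega> - \<mu> 0 / \<mu> r * X 0 \<omega>)"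
    using gaussian_innovation_residual[of 0 r] assms by (simp add: var_def)
  have "AE \<omega> in M. X 0 \<omega> = 0" using solution by (simp add: sde_solution_def)
  then show "AE \<omega> in M. (\<lambda>_. X r \<omega> - \<mu> 0 / \<mu> r * X 0 \<omega>) \<longlonglongrightarrow> X r \<omega>"
    by eventually_elim simp
qed (use assms in \<open>auto intro: subalgebra_F X_measurable\<close>)

lemma nn_integral_heat_kernel_X:
  "0 < r \<Longrightarrow> 0 < \<epsilon> \<Longrightarrow> (\<integral>\<^sup>+\<omega>. ennreal (heat_kernel \<epsilon> (X r \<omega>)) \<partial>M) = ennreal (heat_kernel (\<epsilon> + var r) 0)"
  by (rule nn_integral_heat_kernel_gaussian[OF gaussian_innovation_X])

lemma nn_integral_heat_kernel_X_X:
  assumes "0 < s" "0 < r" "s \<noteq> r" "0 < \<epsilon>"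
  shows "(\<integral>\<^sup>+\<omega>. ennreal (heat_kernel \<epsilon> (X s \<omega>) * heat_kernel \<epsilon> (X r \<omega>)) \<partial>M) =
    ennreal (1 / (2 * pi * sqrt ((\<epsilon> + var s) * (\<epsilon> + var r) - sq_corr s r * (var s * var r))))"
  using assms
proof (induction s r rule: linorder_wlog)
  case (le s r)
  then have sr: "0 \<le> s" "0 < s" "s < r" by auto
  define \<kappa> where "\<kappa> = \<mu> s / \<mu> r"
  have var_r: "\<kappa>\<^sup>2 * var s + (clock r - clock s) / (\<mu> r)\<^sup>2 = var r"
    by (simp add: \<kappa>_def var_def power_divide diff_divide_distrib)
  have "(\<integral>\<^sup>+\<omega>. ennreal (heat_kernel \<epsilon> (X s \<omega>) * heat_kernel \<epsilon> (X r \<omega>)) \<partial>M) =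
      (\<integral>\<^sup>+\<omega>. ennreal (heat_kernel \<epsilon> (X s \<omega>) * heat_kernel \<epsilon> (\<kappa> * X s \<omega> + (X r \<omega> - \<kappa> * X s \<omega>))) \<partial>M)"
    by simp
  also have "\<dots> = ennreal (1 / (2 * pi * sqrt ((\<epsilon> + var s) * (\<epsilon> + var r) - (\<kappa> * var s)\<^sup>2)))"
    unfolding var_r[symmetric] unfolding \<kappa>_def
    by (rule nn_integral_heat_kernel_mult_regression[OF subalgebra_F[OF sr(1)] gaussian_innovation_X[OF sr(2)]
          X_adapted[OF sr(1)] gaussian_innovation_residual[OF sr(1,3)] le(5)])
  finally show ?case
    unfolding \<kappa>_def sq_corr_mult_var_var[OF sr(2,3), symmetric] .
next
  case (sym s r)
  then show ?case by (simp add: mult.commute sq_corr_commute)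
qed

lemma nn_integral_heat_kernel_X_X_le:
  assumes "0 < s" "0 < r" "s \<noteq> r" "0 < \<epsilon>"
  shows "(\<integral>\<^sup>+\<omega>. ennreal (heat_kernel \<epsilon> (X s \<omega>) * heat_kernel \<epsilon> (X r \<omega>)) \<partial>M) \<le>
    ennreal (heat_kernel (\<epsilon> + var s) 0 * heat_kernel (\<epsilon> + var r) 0 +
      (cov_majorant s r + cov_majorant r s) / (4 * pi))"
proof -
  let ?q = "sq_corr s r" and ?a = "(\<epsilon> + var s) * (\<epsilon> + var r)"
  have q: "0 < ?q" "?q < 1" and v: "0 < var s" "0 < var r"
    using assms by (auto intro: sq_corr_pos sq_corr_less_1 var_pos)
  have "1 / sqrt (?a - ?q * (var s * var r)) \<le> 1 / sqrt ?a + ?q / sqrt (1 - ?q) / sqrt (var s * var r)"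
    using q v \<open>0 < \<epsilon>\<close> by (intro inverse_sqrt_diff_le) (auto intro!: mult_mono)
  also have "?q / sqrt (1 - ?q) / sqrt (var s * var r) \<le> ?q / sqrt (1 - ?q) * ((1 / var s + 1 / var r) / 2)"
    using mult_left_mono[OF inverse_sqrt_mult_le[OF v], of "?q / sqrt (1 - ?q)"] q by simp
  also have "\<dots> = (cov_majorant s r + cov_majorant r s) / 2"
    by (simp add: cov_majorant_def sq_corr_commute[of r s] add_divide_distrib distrib_left)
  finally have "1 / (2 * pi) * (1 / sqrt (?a - ?q * (var s * var r))) \<le>
      1 / (2 * pi) * (1 / sqrt ?a + (cov_majorant s r + cov_majorant r s) / 2)"
    by (intro mult_left_mono) auto
  then show ?thesis
    unfolding nn_integral_heat_kernel_X_X[OF assms] heat_kernel_0_mult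
    by (intro ennreal_leI) (simp add: distrib_left add_divide_distrib)
qed

lemma nn_integral_approx_local_time_0:
  assumes "0 < \<epsilon>"
  shows "(\<integral>\<^sup>+\<omega>. ennreal (approx_local_time X 0 \<epsilon> t \<omega>) \<partial>M) =
    (\<integral>\<^sup>+r\<in>{0..t}. ennreal (heat_kernel (\<epsilon> + var r) 0) \<partial>lborel)"
  unfolding nn_integral_approx_local_time[OF assms]
proof (rule nn_integral_cong_AE)
  show "AE r in lborel. (\<integral>\<^sup>+\<omega>. ennreal (heat_kernel \<epsilon> (X r \<omega> - 0)) \<partial>M) * indicator {0..t} r =
      ennreal (heat_kernel (\<epsilon> + var r) 0) * indicator {0..t} r"
    using AE_lborel_singleton[of 0]
    by eventually_elim (use assms in \<open>auto simp: nn_integral_heat_kernel_X split: split_indicator\<close>)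
qed

lemma nn_integral_approx_local_time_0_finite:
  assumes "0 < \<epsilon>"
  shows "(\<integral>\<^sup>+\<omega>. ennreal (approx_local_time X 0 \<epsilon> t \<omega>) \<partial>M) < \<infinity>"
proof -
  have "(\<integral>\<^sup>+\<omega>. ennreal (approx_local_time X 0 \<epsilon> t \<omega>) \<partial>M) \<le> (\<integral>\<^sup>+r\<in>{0..t}. ennreal (heat_kernel \<epsilon> 0) \<partial>lborel)"
    unfolding nn_integral_approx_local_time_0[OF assms] using assms
    by (intro nn_integral_mono)
      (auto split: split_indicator intro!: ennreal_leI heat_kernel_le_heat_kernel_0 simp: var_nonneg)
  also have "\<dots> < \<infinity>"
    by (simp add: nn_integral_cmult ennreal_mult_less_top emeasure_lborel_Icc_eq)
  finally show ?thesis .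
qed

lemma nn_integral_approx_local_time_0_power2_le:
  assumes "0 < \<epsilon>" "0 \<le> t"
  shows "(\<integral>\<^sup>+\<omega>. (ennreal (approx_local_time X 0 \<epsilon> t \<omega>))\<^sup>2 \<partial>M) \<le>
    (\<integral>\<^sup>+\<omega>. ennreal (approx_local_time X 0 \<epsilon> t \<omega>) \<partial>M)\<^sup>2 + ennreal (2 * t / pi)"
proof -
  define m where "m r = ennreal (heat_kernel (\<epsilon> + var r) 0)" for r
  define k where "k s r = ennreal (1 / (4 * pi)) * ennreal (cov_majorant s r)" for s r
  have m: "m \<in> borel_measurable lborel" and k: "case_prod k \<in> borel_measurable (lborel \<Otimes>\<^sub>M lborel)"
    unfolding m_def k_def heat_kernel_def by measurable
  have "(\<integral>\<^sup>+\<omega>. ennreal (heat_kernel \<epsilon> (X s \<omega>) * heat_kernel \<epsilon> (X r \<omega>)) \<partial>M) \<le> m s * m r + (k s r + k r s)"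
    if "0 < s" "0 < r" "s \<noteq> r" for s r
    using nn_integral_heat_kernel_X_X_le[OF that \<open>0 < \<epsilon>\<close>] that \<open>0 < \<epsilon>\<close>
      cov_majorant_nonneg[of s r] cov_majorant_nonneg[of r s]
    by (simp add: m_def k_def ennreal_mult[symmetric] ennreal_plus[symmetric] heat_kernel_nonneg var_nonneg
        add_divide_distrib del: ennreal_plus)
  then have "(\<integral>\<^sup>+\<omega>. (ennreal (approx_local_time X 0 \<epsilon> t \<omega>))\<^sup>2 \<partial>M) \<le>
      (\<integral>\<^sup>+s\<in>{0..t}. (\<integral>\<^sup>+r\<in>{0..t}. m s * m r + (k s r + k r s) \<partial>lborel) \<partial>lborel)"
    unfolding nn_integral_approx_local_time_power2[OF assms(1)] diff_0_right
    by (intro nn_integral_lborel_mono_off_diagonal)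
  also have "\<dots> = (\<integral>\<^sup>+s\<in>{0..t}. m s \<partial>lborel)\<^sup>2 + 2 * (\<integral>\<^sup>+s\<in>{0..t}. (\<integral>\<^sup>+r\<in>{0..t}. k s r \<partial>lborel) \<partial>lborel)"
    by (rule lborel.nn_integral_product_plus_symmetrization[OF m k]) simp
  also have "(\<integral>\<^sup>+s\<in>{0..t}. (\<integral>\<^sup>+r\<in>{0..t}. k s r \<partial>lborel) \<partial>lborel) =
      ennreal (1 / (4 * pi)) * (\<integral>\<^sup>+s\<in>{0..t}. (\<integral>\<^sup>+r\<in>{0..t}. ennreal (cov_majorant s r) \<partial>lborel) \<partial>lborel)"
    by (simp add: k_def mult.assoc nn_integral_cmult)
  also have "2 * (ennreal (1 / (4 * pi)) *
      (\<integral>\<^sup>+s\<in>{0..t}. (\<integral>\<^sup>+r\<in>{0..t}. ennreal (cov_majorant s r) \<partial>lborel) \<partial>lborel)) \<le>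
      2 * (ennreal (1 / (4 * pi)) * ennreal (4 * t))"
    by (intro mult_left_mono nn_integral_nn_integral_cov_majorant_le assms) auto
  also have "2 * (ennreal (1 / (4 * pi)) * ennreal (4 * t)) = ennreal (2 * t / pi)"
    using ennreal_mult'[of 2 "t / pi"] \<open>0 \<le> t\<close> by (simp add: ennreal_mult[symmetric])
  also have "(\<integral>\<^sup>+s\<in>{0..t}. m s \<partial>lborel) = (\<integral>\<^sup>+\<omega>. ennreal (approx_local_time X 0 \<epsilon> t \<omega>) \<partial>M)"
    using assms by (simp add: nn_integral_approx_local_time_0 m_def)
  finally show ?thesis by (simp add: add_left_mono)
qed

end

section \<open>Divergence of the local time\<close>

locale coercive_ou_process = ou_process + coercive_drift
begin

definition growth_rate :: real where
  "growth_rate = heat_kernel (1 + 1 / (2 * c)) 0"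

lemma growth_rate_pos: "0 < growth_rate"
  using c_pos by (simp add: growth_rate_def heat_kernel_def add_pos_pos)

lemma growth_rate_le_nn_integral_approx_local_time_0:
  assumes "0 < \<epsilon>" "\<epsilon> \<le> 1" "0 \<le> t"
  shows "ennreal (growth_rate * t) \<le> (\<integral>\<^sup>+\<omega>. ennreal (approx_local_time X 0 \<epsilon> t \<omega>) \<partial>M)"
proof -
  have "ennreal (growth_rate * t) = (\<integral>\<^sup>+r\<in>{0..t}. ennreal growth_rate \<partial>lborel)"
    using assms growth_rate_pos by (simp add: nn_integral_cmult ennreal_mult)
  also have "\<dots> \<le> (\<integral>\<^sup>+r\<in>{0..t}. ennreal (heat_kernel (\<epsilon> + var r) 0) \<partial>lborel)"
  proof (rule nn_integral_mono)
    have "growth_rate \<le> heat_kernel (\<epsilon> + var r) 0" if "0 \<le> r" for r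
      unfolding growth_rate_def using var_nonneg[OF that] var_le[OF that] assms
      by (intro heat_kernel_le_heat_kernel_0) auto
    then show "ennreal growth_rate * indicator {0..t} r \<le>
        ennreal (heat_kernel (\<epsilon> + var r) 0) * indicator {0..t} r" for r
      by (auto split: split_indicator intro: ennreal_leI)
  qed
  finally show ?thesis using assms by (simp add: nn_integral_approx_local_time_0)
qed

lemma prob_approx_local_time_le:
  assumes "0 < \<epsilon>" "\<epsilon> \<le> 1" "0 < t"
  shows "prob {\<omega> \<in> space M. approx_local_time X 0 \<epsilon> t \<omega> \<le> growth_rate * t / 2} \<le> 8 / (pi * growth_rate\<^sup>2 * t)"
proof -
  have "prob {\<omega> \<in> space M. approx_local_time X 0 \<epsilon> t \<omega> \<le> growth_rate * t / 2} \<le>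
      4 * (2 * t / pi) / (growth_rate * t)\<^sup>2"
    using assms growth_rate_pos
    by (intro prob_le_half_mean approx_local_time_measurable approx_local_time_nonneg
        growth_rate_le_nn_integral_approx_local_time_0 nn_integral_approx_local_time_0_finite
        nn_integral_approx_local_time_0_power2_le) auto
  also have "\<dots> = 8 / (pi * growth_rate\<^sup>2 * t)"
    using assms growth_rate_pos by (simp add: power2_eq_square)
  finally show ?thesis .
qed

lemma emeasure_local_time_le:
  assumes L: "local_time M X 0 L" and "0 < t"
  shows "emeasure M {\<omega> \<in> space M. L t \<omega> \<le> growth_rate * t / 4} \<le> ennreal (8 / (pi * growth_rate\<^sup>2 * t))"
proof (rule emeasure_le_of_L2_limit)
  show "L t \<in> borel_measurable M"
    "((\<lambda>\<epsilon>. \<integral>\<^sup>+\<omega>. ennreal ((approx_local_time X 0 \<epsilon> t \<omega> - L t \<omega>)\<^sup>2) \<partial>M) \<longlongrightarrow> 0) (at_right 0)"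
    using L \<open>0 < t\<close> by (auto simp: local_time_def)
  show "\<forall>\<^sub>F \<epsilon> in at_right 0. approx_local_time X 0 \<epsilon> t \<in> borel_measurable M \<and>
      emeasure M {\<omega> \<in> space M. approx_local_time X 0 \<epsilon> t \<omega> \<le> growth_rate * t / 2} \<le>
        ennreal (8 / (pi * growth_rate\<^sup>2 * t))"
  proof (intro eventually_at_rightI[of 0 1] conjI)
    fix \<epsilon> :: real assume "\<epsilon> \<in> {0<..<1}"
    then show "approx_local_time X 0 \<epsilon> t \<in> borel_measurable M"
      "emeasure M {\<omega> \<in> space M. approx_local_time X 0 \<epsilon> t \<omega> \<le> growth_rate * t / 2} \<le>
        ennreal (8 / (pi * growth_rate\<^sup>2 * t))"
      unfolding emeasure_eq_measure using \<open>0 < t\<close>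
      by (simp, intro ennreal_leI prob_approx_local_time_le) auto
  qed simp
  show "growth_rate * t / 4 < growth_rate * t / 2" using growth_rate_pos \<open>0 < t\<close> by simp
qed simp

theorem AE_local_time_at_top:
  assumes L: "local_time M X 0 L"
  shows "AE \<omega> in M. filterlim (\<lambda>t. L t \<omega>) at_top at_top"
proof (rule AE_filterlim_at_top_of_tendsto_in_measure)
  fix z :: real
  have "((\<lambda>t. 8 / (pi * growth_rate\<^sup>2) / t) \<longlongrightarrow> 0) at_top"
    by (intro tendsto_divide_0[OF tendsto_const] filterlim_at_top_imp_at_infinity filterlim_ident)
  then have bound_lim: "((\<lambda>t. ennreal (8 / (pi * growth_rate\<^sup>2 * t))) \<longlongrightarrow> ennreal 0) at_top"
    by (intro tendsto_ennrealI) simp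
  have bound: "\<forall>\<^sub>F t in at_top. emeasure M {\<omega> \<in> space M. L t \<omega> \<le> z} \<le> ennreal (8 / (pi * growth_rate\<^sup>2 * t))"
    using eventually_gt_at_top[of 0] eventually_ge_at_top[of "4 * z / growth_rate"]
  proof eventually_elim
    case (elim t)
    have "z \<le> growth_rate * t / 4" using elim(2) growth_rate_pos by (simp add: field_simps)
    moreover have "L t \<in> borel_measurable M" using L elim(1) by (simp add: local_time_def)
    ultimately have "emeasure M {\<omega> \<in> space M. L t \<omega> \<le> z} \<le>
        emeasure M {\<omega> \<in> space M. L t \<omega> \<le> growth_rate * t / 4}"
      by (intro emeasure_mono) auto
    also have "\<dots> \<le> ennreal (8 / (pi * growth_rate\<^sup>2 * t))"
      by (rule emeasure_local_time_le[OF L elim(1)])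
    finally show ?case .
  qed
  show "((\<lambda>t. emeasure M {\<omega> \<in> space M. L t \<omega> \<le> z}) \<longlongrightarrow> 0) at_top"
    by (rule tendsto_sandwich[OF _ bound tendsto_const bound_lim[unfolded ennreal_0]]) simp
qed (use L in \<open>auto simp: local_time_def\<close>)

end

theorem theorem3p2:
  fixes M :: "'a measure" and F :: "real \<Rightarrow> 'a measure"
    and W X L :: "real \<Rightarrow> 'a \<Rightarrow> real" and \<alpha> \<alpha>' :: "real \<Rightarrow> real"
  assumes "complete_filtered_prob_space M F"
    and "brownian_motion M F W"
    and "\<And>t. 0 \<le> t \<Longrightarrow> 0 < \<alpha> t"
    and "\<And>t. 0 \<le> t \<Longrightarrow> (\<alpha> has_real_derivative \<alpha>' t) (at t within {0..})"
    and "continuous_on {0..} \<alpha>'"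
    (* at t = 0 the bound is vacuous by the convention that 0 to a negative power is infinite *)
    and "\<exists>\<gamma> \<beta> C. 0 \<le> \<gamma> \<and> \<gamma> \<le> 1 / 2 \<and> 0 < \<beta> \<and> 0 < C \<and>
           (\<forall>t>0. running_sup \<alpha> (t + 1) powr (2 * \<gamma>) / \<alpha> t \<le> C * t powr (- \<beta>))"
    and "bdd_above ((\<lambda>t. \<bar>\<alpha>' t / \<alpha> t\<bar>) ` {0..})"
    and "\<exists>\<rho> t0 C. 1 < \<rho> \<and> 0 < t0 \<and> 0 < C \<and> (\<forall>t\<ge>t0. C * t powr \<rho> \<le> \<alpha> t)"
    and "sde_solution M F W \<alpha> X"
    and "local_time M X 0 L"
  shows "AE \<omega> in M. filterlim (\<lambda>t. L t \<omega>) at_top at_top"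
proof -
  interpret complete_filtered_prob_space M F by fact
  have cont_\<alpha>: "continuous_on {0..} \<alpha>"
    using assms(4) by (auto simp: continuous_on_eq_continuous_within intro!: DERIV_continuous)
  obtain \<rho> t0 C where \<rho>: "1 < \<rho>" "0 < C" "\<And>t. t0 \<le> t \<Longrightarrow> C * t powr \<rho> \<le> \<alpha> t"
    using assms(8) by blast
  then have "\<forall>\<^sub>F t in at_top. C \<le> \<alpha> t"
    by (intro eventually_ge_of_powr_le[where \<rho> = \<rho> and t\<^sub>0 = t0]) auto
  then obtain c where c: "0 < c" "\<And>t. 0 \<le> t \<Longrightarrow> c \<le> \<alpha> t"
    using continuous_positive_imp_bounded_below[OF cont_\<alpha> assms(3) \<rho>(2)] by blast
  have "adapted F X" "continuous_paths M X"
    using assms(9) by (simp_all add: sde_solution_def)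
  then obtain X' where X': "adapted F X'" "\<And>\<omega>. continuous_on {0..} (\<lambda>t. X' t \<omega>)"
    "AE \<omega> in M. \<forall>t. X' t \<omega> = X t \<omega>"
    by (rule adapted_continuous_version) blast
  interpret coercive_ou_process M F W \<alpha> X' c
    using assms(2) cont_\<alpha> c X'(2) sde_solution_cong_AE[OF assms(9) X'(1,3)] by unfold_locales
  show ?thesis
    by (rule AE_local_time_at_top[OF local_time_cong_AE[OF assms(10) X'(3)]])
qed

end
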